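(* With notation as in the context, the conformal factor $\rho^{-1}$, viewed as a function of $(u,v)$ on $\tilde\Omega^*=\tilde\Omega\setminus\{(0,0)\}$, is harmonic on the interior of $\tilde\Omega^*$, and hence, writing $z=u+iv$, \[ \rho^{-1}=-C\log|z|+h(z) \] for some constant $C\ge0$ and some smooth harmonic function $h$ on the interior of $\tilde\Omega$.
   Context: Let $\lambda$ be Lebesgue measure on $\mathbb{R}^2$. Let $\Omega=\mathrm{Hull}\{(-\tfrac12,-\tfrac12),(-\tfrac16,-\tfrac12),(\tfrac12,\tfrac12),(-\tfrac12,-\tfrac16)\}$ and $\Theta=\mathrm{Hull}\{(-\tfrac16,-\tfrac16),(\tfrac12,-\tfrac12),(\tfrac56,-\tfrac12),(0,0)\}\cup\mathrm{Hull}\{(-\tfrac16,-\tfrac16),(-\tfrac12,\tfrac12),(-\tfrac12,\tfrac56),(0,0)\}$. Let $\varphi$ be the Brenier potential: a convex function on $\Omega$ whose gradient pushes $\chi_\Omega\lambda$ forward to $\chi_\Theta\lambda$ (unique up to additive constant); it is smooth and strictly convex on $\Omega\setminus\{y=x\ge0\}$ with $\varphi_{xx}\varphi_{yy}-\varphi_{xy}^2=1$ there. Set $u=x-y$, $v=\varphi_x+\varphi_y$ (extended continuously to $\Omega$), $\rho=\varphi_{xx}+2\varphi_{xy}+\varphi_{yy}$ (which extends to a continuous positive function on $\Omega\setminus\{(0,0)\}$), $f=(u,v)$, a homeomorphism of $\Omega$ onto $\tilde\Omega:=f(\Omega)$ fixing the origin; $\rho$ is regarded as a function on $\tilde\Omega\setminus\{(0,0)\}$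 via $f^{-1}$. Harmonic means with respect to the Euclidean Laplacian in $(u,v)$. *)

theory Defs
  imports "HOL-Analysis.Analysis"
begin

definition px :: "(real \<times> real \<Rightarrow> real) \<Rightarrow> real \<times> real \<Rightarrow> real" where
  "px g p = deriv (\<lambda>t. g (t, snd p)) (fst p)"

definition py :: "(real \<times> real \<Rightarrow> real) \<Rightarrow> real \<times> real \<Rightarrow> real" where
  "py g p = deriv (\<lambda>t. g (fst p, t)) (snd p)"

fun C_k :: "nat \<Rightarrow> (real \<times> real) set \<Rightarrow> (real \<times> real \<Rightarrow> real) \<Rightarrow> bool" where
  "C_k 0 U g = continuous_on U g"
| "C_k (Suc k) U g = ((\<forall>p\<in>U. g differentiable (at p)) \<and> C_k k U (px g) \<and> C_k k U (py g))"

definition smooth_on :: "(real \<times> real) set \<Rightarrow> (real \<times> real \<Rightarrow> real) \<Rightarrow> bool" where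
  "smooth_on U g \<longleftrightarrow> (\<forall>k. C_k k U g)"

definition harmonic_on :: "(real \<times> real) set \<Rightarrow> (real \<times> real \<Rightarrow> real) \<Rightarrow> bool" where
  "harmonic_on U g \<longleftrightarrow> open U \<and> C_k 2 U g \<and> (\<forall>p\<in>U. px (px g) p + py (py g) p = 0)"

definition Omega :: "(real \<times> real) set" where
  "Omega = convex hull {(-1/2, -1/2), (-1/6, -1/2), (1/2, 1/2), (-1/2, -1/6)}"

definition Theta :: "(real \<times> real) set" where
  "Theta = convex hull {(-1/6, -1/6), (1/2, -1/2), (5/6, -1/2), (0, 0)}
         \<union> convex hull {(-1/6, -1/6), (-1/2, 1/2), (-1/2, 5/6), (0, 0)}"

definition Ray :: "(real \<times> real) set" where
  "Ray = {(x, x) | x. x \<ge> 0}"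

end

theory Submission
  imports Defs "HOL-Complex_Analysis.Complex_Analysis"
begin

text \<open>
  Put \<open>s = (x + y) / 2\<close> and \<open>d = (\<phi>\<^sub>x - \<phi>\<^sub>y) / 2\<close>. By the partial Legendre transform, the
  Monge--Ampere equation says that \<open>F = s + i d\<close> is a holomorphic function of \<open>w = v + i u\<close>
  off the slit \<open>w \<ge> 0\<close>, with \<open>Re F' = 1 / \<rho>\<close>. The Brenier potential is symmetric in \<open>x\<close> and \<open>y\<close>,
  so the two sides of the slit are carried to the two pieces of \<open>Theta\<close>, and since no mass lands in
  the gap \<open>\<bar>d\<bar> < 2 v\<close> while the pieces are filled completely, \<open>d\<close> tends (in the mean) to
  \<open>2 v\<close> on one side of the slit and to \<open>- 2 v\<close> on the other. By Schwarz reflection of a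
  primitive, the function equal to \<open>F - 2 i w\<close> for \<open>u > 0\<close> and to \<open>F + 2 i w\<close> for \<open>u < 0\<close>
  continues across the slit. The function \<open>- (2 / \<pi>) w Log (- w)\<close> has the same jump, so
  \<open>F + (2 / \<pi>) w Log (- w)\<close> is holomorphic outside the origin, and it is bounded, whence the
  singularity is removable. Taking real parts of derivatives gives the claim with \<open>C = 2 / \<pi>\<close>.
\<close>

subsection \<open>Partial derivatives and harmonic functions\<close>

lemma has_derivative_px:
  assumes "(g has_derivative D) (at p)"
  shows "((\<lambda>t. g (t, snd p)) has_real_derivative D (1, 0)) (at (fst p))"
proof -
  interpret D: bounded_linear D using assms by (rule has_derivative_bounded_linear)
  have "((\<lambda>t. g (t, snd p)) has_derivative (\<lambda>t. D (t, 0))) (at (fst p))"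
    by (rule has_derivative_compose[where g = g and f = "\<lambda>t. (t, snd p)", simplified])
       (auto intro!: derivative_eq_intros assms)
  moreover have "(\<lambda>t. D (t, 0)) = (*) (D (1, 0))"
  proof
    fix t show "D (t, 0) = D (1, 0) * t" using D.scaleR[of t "(1, 0)"] by simp
  qed
  ultimately show ?thesis by (simp add: has_field_derivative_def)
qed

lemma has_derivative_py:
  assumes "(g has_derivative D) (at p)"
  shows "((\<lambda>t. g (fst p, t)) has_real_derivative D (0, 1)) (at (snd p))"
proof -
  interpret D: bounded_linear D using assms by (rule has_derivative_bounded_linear)
  have "((\<lambda>t. g (fst p, t)) has_derivative (\<lambda>t. D (0, t))) (at (snd p))"
    by (rule has_derivative_compose[where g = g and f = "\<lambda>t. (fst p, t)", simplified])
       (auto intro!: derivative_eq_intros assms)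
  moreover have "(\<lambda>t. D (0, t)) = (*) (D (0, 1))"
  proof
    fix t show "D (0, t) = D (0, 1) * t" using D.scaleR[of t "(0, 1)"] by simp
  qed
  ultimately show ?thesis by (simp add: has_field_derivative_def)
qed

lemma px_eq: "(g has_derivative D) (at p) \<Longrightarrow> px g p = D (1, 0)"
  unfolding px_def by (rule DERIV_imp_deriv) (rule has_derivative_px)

lemma py_eq: "(g has_derivative D) (at p) \<Longrightarrow> py g p = D (0, 1)"
  unfolding py_def by (rule DERIV_imp_deriv) (rule has_derivative_py)

lemma differentiable_px_py:
  assumes "g differentiable (at p)"
  shows "(g has_derivative (\<lambda>k. px g p * fst k + py g p * snd k)) (at p)"
proof -
  obtain D where D: "(g has_derivative D) (at p)" using assms by (auto simp: differentiable_def)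
  interpret D: bounded_linear D using D by (rule has_derivative_bounded_linear)
  have "D k = px g p * fst k + py g p * snd k" for k
  proof -
    have "D k = D (fst k *\<^sub>R (1, 0) + snd k *\<^sub>R (0, 1))" by (cases k) simp
    also have "\<dots> = px g p * fst k + py g p * snd k"
      unfolding D.add D.scaleR px_eq[OF D] py_eq[OF D] by (simp add: mult.commute)
    finally show ?thesis .
  qed
  then have "D = (\<lambda>k. px g p * fst k + py g p * snd k)" by blast
  then show ?thesis using D by simp
qed

lemma px_cong:
  assumes "open U" "p \<in> U" "\<And>q. q \<in> U \<Longrightarrow> g q = g' q"
  shows "px g p = px g' p"
  unfolding px_def
proof (rule deriv_cong_ev)
  have "open ((\<lambda>t. (t, snd p)) -` U)"
    by (rule open_vimage[OF assms(1)]) (intro continuous_intros)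
  moreover have "fst p \<in> (\<lambda>t. (t, snd p)) -` U" using assms(2) by simp
  ultimately show "\<forall>\<^sub>F t in nhds (fst p). g (t, snd p) = g' (t, snd p)"
    unfolding eventually_nhds using assms(3) by blast
qed simp

lemma py_cong:
  assumes "open U" "p \<in> U" "\<And>q. q \<in> U \<Longrightarrow> g q = g' q"
  shows "py g p = py g' p"
  unfolding py_def
proof (rule deriv_cong_ev)
  have "open ((\<lambda>t. (fst p, t)) -` U)"
    by (rule open_vimage[OF assms(1)]) (intro continuous_intros)
  moreover have "snd p \<in> (\<lambda>t. (fst p, t)) -` U" using assms(2) by simp
  ultimately show "\<forall>\<^sub>F t in nhds (snd p). g (fst p, t) = g' (fst p, t)"
    unfolding eventually_nhds using assms(3) by blast
qed simp

lemma C_k_cong: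
  assumes "open U" "\<And>q. q \<in> U \<Longrightarrow> g q = g' q"
  shows "C_k k U g \<longleftrightarrow> C_k k U g'"
  using assms(2)
proof (induction k arbitrary: g g')
  case 0
  then show ?case by (simp cong: continuous_on_cong)
next
  case (Suc k)
  have "g differentiable (at p) \<longleftrightarrow> g' differentiable (at p)" if "p \<in> U" for p
    using assms(1) that Suc.prems unfolding differentiable_def
    by (metis has_derivative_transform_within_open)
  moreover have "C_k k U (px g) = C_k k U (px g')"
    by (rule Suc.IH) (rule px_cong[OF assms(1)], auto simp: Suc.prems)
  moreover have "C_k k U (py g) = C_k k U (py g')"
    by (rule Suc.IH) (rule py_cong[OF assms(1)], auto simp: Suc.prems)
  ultimately show ?case by simp
qed

lemma C_k_imp_continuous_on: "C_k k U g \<Longrightarrow> continuous_on U g"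
  by (cases k) (auto intro!: differentiable_imp_continuous_within continuous_at_imp_continuous_on)

text \<open>The imaginary axis carries the first coordinate, so that the slit
  \<open>Ray\<close>, on which \<open>u = x - y\<close> vanishes, is sent to the positive reals.\<close>

definition cplx :: "real \<times> real \<Rightarrow> complex" where
  "cplx z = Complex (snd z) (fst z)"

lemma Re_cplx [simp]: "Re (cplx z) = snd z" and Im_cplx [simp]: "Im (cplx z) = fst z"
  by (simp_all add: cplx_def)

lemma cplx_eq_0_iff [simp]: "cplx z = 0 \<longleftrightarrow> z = (0, 0)"
  by (cases z) (auto simp: complex_eq_iff)

lemma norm_cplx [simp]: "norm (cplx z) = norm z"
  by (cases z) (simp add: cmod_def norm_Pair add.commute)

lemma bounded_linear_cplx: "bounded_linear cplx"
  by (rule bounded_linear_intro[where K = 1]) (auto simp: complex_eq_iff)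

lemma has_derivative_cplx [derivative_intros]: "(cplx has_derivative cplx) F"
  by (rule bounded_linear_imp_has_derivative[OF bounded_linear_cplx])

lemma continuous_on_cplx [continuous_intros]: "continuous_on S cplx"
  by (rule linear_continuous_on[OF bounded_linear_cplx])

lemma open_cplx_image: "open U \<Longrightarrow> open (cplx ` U)"
  by (rule invariance_of_domain_gen) (auto simp: inj_on_def complex_eq_iff prod_eq_iff intro: continuous_intros)

lemma has_derivative_Re_cplx:
  assumes "(G has_field_derivative G') (at (cplx z))"
  shows "((\<lambda>z. Re (G (cplx z))) has_derivative (\<lambda>k. Re (G' * cplx k))) (at z)"
  by (rule has_derivative_Re, rule has_derivative_compose[OF has_derivative_cplx])
     (rule assms[unfolded has_field_derivative_def])

text \<open>Since \<open>cplx (1, 0)\<close> is \<open>\<i>\<close> and \<open>cplx (0, 1)\<close>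
  is 1, the partial derivatives of \<open>Re (G w)\<close> are \<open>Re (\<i> * G' w)\<close> and
  \<open>Re (G' w)\<close>: again real parts of holomorphic functions, so induction on the order
  applies.\<close>

lemma C_k_Re_holomorphic:
  assumes "open U" "G holomorphic_on (cplx ` U)"
  shows "C_k k U (\<lambda>z. Re (G (cplx z)))"
  using assms(2)
proof (induction k arbitrary: G)
  case 0
  then have "continuous_on U (\<lambda>z. G (cplx z))"
    by (intro continuous_on_compose2[OF holomorphic_on_imp_continuous_on continuous_on_cplx]) auto
  then show ?case by (auto intro: continuous_on_Re)
next
  case (Suc k)
  have hd: "((\<lambda>z. Re (G (cplx z))) has_derivative (\<lambda>k. Re (deriv G (cplx z) * cplx k))) (at z)"
    if "z \<in> U" for z
    by (intro has_derivative_Re_cplx holomorphic_derivI[OF Suc.prems open_cplx_image[OF assms(1)]])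
       (use that in auto)
  have px: "px (\<lambda>z. Re (G (cplx z))) z = Re (\<i> * deriv G (cplx z))" if "z \<in> U" for z
    using px_eq[OF hd[OF that]] by simp
  have py: "py (\<lambda>z. Re (G (cplx z))) z = Re (deriv G (cplx z))" if "z \<in> U" for z
    using py_eq[OF hd[OF that]] by simp
  have dh: "deriv G holomorphic_on cplx ` U"
    by (rule holomorphic_deriv[OF Suc.prems open_cplx_image[OF assms(1)]])
  have "C_k k U (\<lambda>z. Re (\<i> * deriv G (cplx z)))" "C_k k U (\<lambda>z. Re (deriv G (cplx z)))"
    by (rule Suc.IH[of "\<lambda>w. \<i> * deriv G w"], intro holomorphic_intros dh)
       (rule Suc.IH[OF dh])
  then have "C_k k U (px (\<lambda>z. Re (G (cplx z))))" "C_k k U (py (\<lambda>z. Re (G (cplx z))))"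
    by (simp_all only: C_k_cong[OF assms(1) px, of "\<lambda>z. z"] C_k_cong[OF assms(1) py, of "\<lambda>z. z"])
  then show ?case using hd by (auto simp: differentiable_def)
qed

text \<open>The criterion speaks of the gradient because \<open>ln (norm z)\<close> is not the real
  part of a single holomorphic function around the origin, whereas its gradient, encoded by
  \<open>1 / w\<close>, is single-valued. The two pure second derivatives are \<open>- Re H'\<close>
  and \<open>Re H'\<close>.\<close>

lemma smooth_harmonic_if_gradient_holomorphic:
  assumes U: "open U" and H: "H holomorphic_on (cplx ` U)"
    and g: "\<And>z. z \<in> U \<Longrightarrow> (g has_derivative (\<lambda>k. Re (H (cplx z) * cplx k))) (at z)"
  shows "smooth_on U g" and "harmonic_on U g"
proof -
  have px: "px g z = Re (\<i> * H (cplx z))" if "z \<in> U" for z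
    using px_eq[OF g[OF that]] by simp
  have py: "py g z = Re (H (cplx z))" if "z \<in> U" for z
    using py_eq[OF g[OF that]] by simp
  have iH: "(\<lambda>w. \<i> * H w) holomorphic_on (cplx ` U)" by (intro holomorphic_intros H)
  have C: "C_k k U (px g)" "C_k k U (py g)" for k
    using C_k_Re_holomorphic[OF U H] C_k_Re_holomorphic[OF U iH]
    by (simp_all only: C_k_cong[OF U px, of "\<lambda>z. z"] C_k_cong[OF U py, of "\<lambda>z. z"])
  have C': "C_k (Suc k) U g" for k using C g unfolding C_k.simps differentiable_def by blast
  have "C_k k U g" for k
    by (cases k) (use C_k_imp_continuous_on[OF C'[of 0]] C' in simp_all)
  then show "smooth_on U g" by (simp add: smooth_on_def)
  have "px (px g) z + py (py g) z = 0" if "z \<in> U" for z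
  proof -
    have d: "(H has_field_derivative deriv H (cplx z)) (at (cplx z))"
      by (rule holomorphic_derivI[OF H open_cplx_image[OF U]]) (use that in auto)
    have "px (px g) z = px (\<lambda>z. Re (\<i> * H (cplx z))) z"
      by (rule px_cong[OF U that px])
    also have "\<dots> = Re (\<i> * deriv H (cplx z) * cplx (1, 0))"
      by (rule px_eq[OF has_derivative_Re_cplx]) (intro DERIV_cmult d)
    finally have 1: "px (px g) z = Re (\<i> * deriv H (cplx z) * cplx (1, 0))" .
    have "py (py g) z = py (\<lambda>z. Re (H (cplx z))) z"
      by (rule py_cong[OF U that py])
    also have "\<dots> = Re (deriv H (cplx z) * cplx (0, 1))"
      by (rule py_eq[OF has_derivative_Re_cplx[OF d]])
    finally show ?thesis using 1 by simp
  qed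
  then show "harmonic_on U g"
    using U C'[of 1] by (simp add: harmonic_on_def numeral_2_eq_2)
qed

lemma has_derivative_ln_norm_cplx:
  assumes "z \<noteq> (0, 0)"
  shows "((\<lambda>z. ln (norm z)) has_derivative (\<lambda>k. Re (1 / cplx z * cplx k))) (at z)"
proof -
  have nz: "norm z \<noteq> 0" using assms by (simp add: zero_prod_def)
  have "((\<lambda>z. ln (norm z)) has_derivative (\<lambda>k. inverse (norm z) * (k \<bullet> sgn z))) (at z)"
    using nz by (auto intro!: derivative_eq_intros has_derivative_norm)
  moreover have "inverse (norm z) * (k \<bullet> sgn z) = Re (1 / cplx z * cplx k)" for k
    using nz by (cases z; cases k)
      (simp add: cplx_def sgn_div_norm norm_Pair inner_Pair Re_divide field_simps power2_eq_square)
  ultimately show ?thesis by simp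
qed

text \<open>The second difference of \<open>g\<close> over a square of side \<open>h\<close> can be
  evaluated by two mean value steps in either order. This gives points near \<open>p\<close> at
  which the two mixed derivatives agree, and continuity moves the equality to
  \<open>p\<close>.\<close>

lemma px_py_commute:
  assumes U: "open U" and C: "C_k 2 U g" and p: "p \<in> U"
  shows "px (py g) p = py (px g) p"
proof -
  obtain x y where xy: "p = (x, y)" by (cases p)
  have d0: "\<And>q. q \<in> U \<Longrightarrow> g differentiable (at q)"
    and d1: "\<And>q. q \<in> U \<Longrightarrow> px g differentiable (at q)"
    and d2: "\<And>q. q \<in> U \<Longrightarrow> py g differentiable (at q)"
    and c1: "continuous_on U (py (px g))" and c2: "continuous_on U (px (py g))"
    using C by (auto simp: numeral_2_eq_2)
  have Dx: "((\<lambda>t. k (t, b)) has_real_derivative px k (a, b)) (at a)"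
    and Dy: "((\<lambda>t. k (a, t)) has_real_derivative py k (a, b)) (at b)"
    if "k differentiable (at (a, b))" for k a b
    using has_derivative_px[OF differentiable_px_py[OF that]]
      has_derivative_py[OF differentiable_px_py[OF that]] by simp_all
  obtain e where e: "e > 0" "cball p e \<subseteq> U" using U p open_contains_cball by blast
  have sq: "(a, b) \<in> U \<and> dist (a, b) p \<le> 2 * h"
    if "h > 0" "2 * h \<le> e" "a \<in> {x..x+h}" "b \<in> {y..y+h}" for a b h
  proof -
    have "dist (a, b) p \<le> \<bar>a - x\<bar> + \<bar>b - y\<bar>"
      unfolding xy dist_Pair_Pair dist_real_def by (rule sqrt_sum_squares_le_sum_abs[THEN order_trans]) simp
    then have "dist (a, b) p \<le> 2 * h" using that by auto
    then show ?thesis using e that by (auto simp: dist_commute)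
  qed
  have ex: "\<exists>q q'. q \<in> U \<and> q' \<in> U \<and> dist q p \<le> 2 * h \<and> dist q' p \<le> 2 * h \<and>
      py (px g) q = px (py g) q'" if h: "h > 0" "2 * h \<le> e" for h
  proof -
    have "\<exists>a>x. a < x + h \<and> (g (x + h, y + h) - g (x + h, y)) - (g (x, y + h) - g (x, y))
        = (x + h - x) * (px g (a, y + h) - px g (a, y))"
      by (rule MVT2[of x "x + h" "\<lambda>t. g (t, y + h) - g (t, y)"])
         (use h sq[OF h] in \<open>auto intro!: DERIV_diff Dx d0\<close>)
    then obtain a where a: "x < a" "a < x + h" and 1:
      "(g (x + h, y + h) - g (x + h, y)) - (g (x, y + h) - g (x, y)) = h * (px g (a, y + h) - px g (a, y))"
      by auto
    have "\<exists>b>y. b < y + h \<and> px g (a, y + h) - px g (a, y) = (y + h - y) * py (px g) (a, b)"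
      by (rule MVT2[of y "y + h" "\<lambda>t. px g (a, t)"])
         (use h a sq[OF h] in \<open>auto intro!: Dy d1\<close>)
    then obtain b where b: "y < b" "b < y + h" and 2:
      "px g (a, y + h) - px g (a, y) = h * py (px g) (a, b)" by auto
    have "\<exists>b>y. b < y + h \<and> (g (x + h, y + h) - g (x, y + h)) - (g (x + h, y) - g (x, y))
        = (y + h - y) * (py g (x + h, b) - py g (x, b))"
      by (rule MVT2[of y "y + h" "\<lambda>t. g (x + h, t) - g (x, t)"])
         (use h sq[OF h] in \<open>auto intro!: DERIV_diff Dy d0\<close>)
    then obtain b' where b': "y < b'" "b' < y + h" and 3:
      "(g (x + h, y + h) - g (x, y + h)) - (g (x + h, y) - g (x, y)) = h * (py g (x + h, b') - py g (x, b'))"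
      by auto
    have "\<exists>a>x. a < x + h \<and> py g (x + h, b') - py g (x, b') = (x + h - x) * px (py g) (a, b')"
      by (rule MVT2[of x "x + h" "\<lambda>t. py g (t, b')"])
         (use h b' sq[OF h] in \<open>auto intro!: Dx d2\<close>)
    then obtain a' where a': "x < a'" "a' < x + h" and 4:
      "py g (x + h, b') - py g (x, b') = h * px (py g) (a', b')" by auto
    have "h * (h * py (px g) (a, b)) = h * (h * px (py g) (a', b'))" 
    proof -
      have "h * (h * py (px g) (a, b)) = (g (x + h, y + h) - g (x + h, y)) - (g (x, y + h) - g (x, y))"
        unfolding 1 2 ..
      also have "\<dots> = (g (x + h, y + h) - g (x, y + h)) - (g (x + h, y) - g (x, y))" by simp
      also have "\<dots> = h * (h * px (py g) (a', b'))" unfolding 3 4 ..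
      finally show ?thesis .
    qed
    then have "py (px g) (a, b) = px (py g) (a', b')" using h by simp
    then show ?thesis using sq[OF h, of a b] sq[OF h, of a' b'] a a' b b'
      by (intro exI[of _ "(a, b)"] exI[of _ "(a', b')"]) auto
  qed
  define h where "h n = e / 2 * inverse (real (Suc n))" for n
  have h: "h n > 0" "2 * h n \<le> e" for n
    using e by (auto simp: h_def field_simps)
  have h0: "h \<longlonglongrightarrow> 0"
    unfolding h_def by (rule tendsto_mult_right_zero[OF LIMSEQ_inverse_real_of_nat])
  obtain q q' where q: "\<And>n. q n \<in> U \<and> q' n \<in> U \<and> dist (q n) p \<le> 2 * h n \<and> dist (q' n) p \<le> 2 * h n \<and>
      py (px g) (q n) = px (py g) (q' n)"
    using ex[OF h] by metis
  have h2: "(\<lambda>n. 2 * h n) \<longlonglongrightarrow> 0" using tendsto_mult[OF tendsto_const[of 2] h0] by simp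
  have conv: "w \<longlonglongrightarrow> p" if "\<And>n. dist (w n) p \<le> 2 * h n" for w
    by (rule tendsto_dist_iff[THEN iffD2], rule tendsto_sandwich[OF _ _ tendsto_const h2])
       (use that in auto)
  have "q \<longlonglongrightarrow> p" "q' \<longlonglongrightarrow> p" using q by (auto intro: conv)
  then have "(\<lambda>n. py (px g) (q n)) \<longlonglongrightarrow> py (px g) p" "(\<lambda>n. px (py g) (q' n)) \<longlonglongrightarrow> px (py g) p"
    using q p continuous_on_tendsto_compose[OF c1, of q p sequentially]
      continuous_on_tendsto_compose[OF c2, of q' p sequentially] by auto
  moreover have "(\<lambda>n. py (px g) (q n)) = (\<lambda>n. px (py g) (q' n))" using q by blast
  ultimately show ?thesis by (metis LIMSEQ_unique)
qed

subsection \<open>The two domains\<close>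

lemma convex_hull_halfplane:
  fixes S :: "(real \<times> real) set"
  assumes "p \<in> convex hull S" "\<forall>x\<in>S. a * fst x + b * snd x \<le> c"
  shows "a * fst p + b * snd p \<le> c"
proof -
  have "convex hull S \<subseteq> {x. (a, b) \<bullet> x \<le> c}"
    by (rule hull_minimal[where S = convex, OF _ convex_halfspace_le])
       (use assms(2) in \<open>auto simp: inner_prod_def\<close>)
  then show ?thesis using assms(1) by (auto simp: inner_prod_def)
qed

lemma linear_swap: "linear (prod.swap :: real \<times> real \<Rightarrow> real \<times> real)"
  by (rule linearI) auto

lemma swap_convex_hull:
  fixes S :: "(real \<times> real) set"
  assumes "p \<in> convex hull S"
  shows "prod.swap p \<in> convex hull (prod.swap ` S)"
  using convex_hull_linear_image[OF linear_swap, of S] assms by blast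

lemma compact_Omega: "compact Omega"
  by (auto simp: Omega_def intro: finite_imp_compact_convex_hull)

lemma swap_Omega: "p \<in> Omega \<Longrightarrow> prod.swap p \<in> Omega"
proof -
  have "prod.swap ` {(-1/2, -1/2), (-1/6, -1/2), (1/2, 1/2), (-1/2, -1/6)} =
      {(-1/2, -1/2), (-1/6, -1/2), (1/2, 1/2), (-1/2, -1/6::real)}" by auto
  then show "p \<in> Omega \<Longrightarrow> prod.swap p \<in> Omega"
    unfolding Omega_def by (metis swap_convex_hull)
qed

lemma swap_interior_Omega:
  assumes "p \<in> interior Omega" shows "prod.swap p \<in> interior Omega"
proof -
  have "open (prod.swap -` interior Omega)"
    by (intro open_vimage open_interior continuous_on_swap)
  moreover have "prod.swap -` interior Omega \<subseteq> Omega"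
    using swap_Omega interior_subset by fastforce
  ultimately have "prod.swap -` interior Omega \<subseteq> interior Omega" by (rule interior_maximal[rotated])
  then show ?thesis using assms by auto
qed

lemma Omega_bounds:
  assumes "p \<in> Omega"
  shows "\<bar>fst p\<bar> \<le> 1/2" "\<bar>snd p\<bar> \<le> 1/2"
proof -
  note H = convex_hull_halfplane[OF assms[unfolded Omega_def]]
  have "1 * fst p + 0 * snd p \<le> 1/2" "-1 * fst p + 0 * snd p \<le> 1/2"
    "0 * fst p + 1 * snd p \<le> 1/2" "0 * fst p + -1 * snd p \<le> 1/2"
    by (rule H; simp)+
  then show "\<bar>fst p\<bar> \<le> 1/2" "\<bar>snd p\<bar> \<le> 1/2" by (auto simp: abs_le_iff)
qed

lemma norm_Omega: "p \<in> Omega \<Longrightarrow> norm p \<le> 1"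
proof -
  assume "p \<in> Omega"
  then have "\<bar>fst p\<bar> + \<bar>snd p\<bar> \<le> 1" using Omega_bounds by fastforce
  then show ?thesis using norm_Pair_le[of "fst p" "snd p"] by simp
qed

lemma origin_in_interior_Omega: "(0, 0) \<in> interior Omega"
proof -
  let ?S = "{-1/12<..<1/12} \<times> {-1/12<..<1/12} :: (real \<times> real) set"
  have "?S \<subseteq> convex hull {(-1/6, -1/2), (1/2, 1/2), (-1/2, -1/6)}"
  proof
    fix p :: "real \<times> real" assume "p \<in> ?S"
    then obtain x y where p: "p = (x, y)" "\<bar>x\<bar> < 1/12" "\<bar>y\<bar> < 1/12" by auto
    \<comment> \<open>\<open>a\<close>, \<open>b\<close>, \<open>c\<close> are barycentric
      coordinates of \<open>p\<close>: the coordinate sum, which is -2/3, 1, -2/3 at the three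
      vertices, determines \<open>b\<close>, and the difference \<open>x - y\<close> determines
      \<open>a - c\<close>.\<close>
    define b where "b = 3/5 * (x + y + 2/3)"
    define a where "a = (1 - b + 3 * (x - y)) / 2"
    define c where "c = (1 - b - 3 * (x - y)) / 2"
    have abc: "0 \<le> a" "0 \<le> b" "0 \<le> c" "a + b + c = 1"
      using p by (auto simp: a_def b_def c_def abs_less_iff field_simps)
    have "p = a *\<^sub>R (-1/6, -1/2) + b *\<^sub>R (1/2, 1/2) + c *\<^sub>R (-1/2, -1/6)"
      by (simp add: p a_def b_def c_def field_simps)
    then show "p \<in> convex hull {(-1/6, -1/2), (1/2, 1/2), (-1/2, -1/6)}"
      unfolding convex_hull_3 using abc by blast
  qed
  also have "\<dots> \<subseteq> Omega" unfolding Omega_def by (rule hull_mono) auto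
  finally show ?thesis
    by (intro interiorI[of ?S]) (auto intro: open_Times)
qed

lemma compact_Theta: "compact Theta"
  unfolding Theta_def by (intro compact_Un finite_imp_compact_convex_hull) auto

lemma swap_Theta: "p \<in> Theta \<Longrightarrow> prod.swap p \<in> Theta"
proof -
  have "prod.swap ` {(-1/6, -1/6), (1/2, -1/2), (5/6, -1/2), (0, 0)} =
      {(-1/6, -1/6), (-1/2, 1/2), (-1/2, 5/6), (0, 0::real)}"
    "prod.swap ` {(-1/6, -1/6), (-1/2, 1/2), (-1/2, 5/6), (0, 0)} =
      {(-1/6, -1/6), (1/2, -1/2), (5/6, -1/2), (0, 0::real)}" by auto
  then show "p \<in> Theta \<Longrightarrow> prod.swap p \<in> Theta"
    unfolding Theta_def by (metis Un_iff swap_convex_hull)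
qed

text \<open>In the target coordinates v = x + y and d = (x - y) / 2, one piece satisfies d >= 2 v
  and the other d <= - 2 v, with equality on the edges joining the origin to (5/6, -1/2) and (-1/2,
  5/6). A linear bound need only be checked at the vertices.\<close>

lemma Theta_gap:
  assumes "q \<in> Theta"
  shows "2 * (fst q + snd q) \<le> (fst q - snd q) / 2 \<or> (fst q - snd q) / 2 \<le> - 2 * (fst q + snd q)"
  using assms unfolding Theta_def
proof
  assume "q \<in> convex hull {(-1/6, -1/6), (1/2, -1/2), (5/6, -1/2), (0, 0)}"
  then have "3/2 * fst q + 5/2 * snd q \<le> 0" by (rule convex_hull_halfplane) simp
  then show ?thesis by argo
next
  assume "q \<in> convex hull {(-1/6, -1/6), (-1/2, 1/2), (-1/2, 5/6), (0, 0)}"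
  then have "5/2 * fst q + 3/2 * snd q \<le> 0" by (rule convex_hull_halfplane) simp
  then show ?thesis by argo
qed

text \<open>Convexity of one piece: it contains \<open>q\<close> and the point of its edge d = 2 v
  with the same coordinate sum, hence the whole segment between them.\<close>

lemma Theta_fill:
  assumes q: "q \<in> Theta" and v: "v = fst q + snd q" "v > 0" and d: "2 * v \<le> d" "d \<le> (fst q - snd q) / 2"
  shows "(v / 2 + d, v / 2 - d) \<in> Theta"
proof -
  let ?H = "convex hull {(-1/6, -1/6), (1/2, -1/2), (5/6, -1/2), (0, 0)} :: (real \<times> real) set"
  have H: "q \<in> ?H"
    using q unfolding Theta_def
  proof
    assume "q \<in> convex hull {(-1/6, -1/6), (-1/2, 1/2), (-1/2, 5/6), (0, 0)}"
    then have "5/2 * fst q + 3/2 * snd q \<le> 0" by (rule convex_hull_halfplane) simp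
    then show ?thesis using v d by argo
  qed
  have v3: "v \<le> 1/3"
    using convex_hull_halfplane[OF H, of 1 1 "1/3"] v by simp
  have "(5/6, -1/2) \<in> ?H" "(0, 0) \<in> ?H" by (auto intro: hull_inc)
  \<comment> \<open>The vertex (5/6, -1/2) has coordinate sum 1/3, so the multiple
    \<open>3 * v\<close> of it is the edge point with sum \<open>v\<close>.\<close>
  then have "(3 * v) *\<^sub>R (5/6, -1/2) + (1 - 3 * v) *\<^sub>R (0, 0) \<in> ?H"
    using v v3 by (intro convexD convex_convex_hull) auto
  then have e: "(v / 2 + 2 * v, v / 2 - 2 * v) \<in> ?H" by (simp add: field_simps)
  define D where "D = (fst q - snd q) / 2"
  have qD: "q = (v / 2 + D, v / 2 - D)" by (simp add: D_def v prod_eq_iff field_simps)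
  have "(v / 2 + d, v / 2 - d) \<in> closed_segment (v / 2 + 2 * v, v / 2 - 2 * v) q"
  proof (cases "D = 2 * v")
    case True
    then show ?thesis using d by (auto simp: qD D_def[symmetric])
  next
    case False
    then have D: "D - 2 * v > 0" using d D_def by linarith
    define t where "t = (d - 2 * v) / (D - 2 * v)"
    have "t * (D - 2 * v) = d - 2 * v" using D by (simp add: t_def)
    then have d_eq: "d = (1 - t) * (2 * v) + t * D" by (simp add: algebra_simps)
    have "(v / 2 + d, v / 2 - d) = (1 - t) *\<^sub>R (v / 2 + 2 * v, v / 2 - 2 * v) + t *\<^sub>R q"
      unfolding qD d_eq scaleR_Pair real_scaleR_def add_Pair prod.inject
      by (simp add: algebra_simps diff_divide_distrib add_divide_distrib)
    moreover have "0 \<le> t" "t \<le> 1" using D d by (auto simp: t_def D_def)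
    ultimately show ?thesis unfolding closed_segment_def by blast
  qed
  then have "(v / 2 + d, v / 2 - d) \<in> ?H"
    using closed_segment_subset[OF e H] by auto
  then show ?thesis by (simp add: Theta_def)
qed

section \<open>The slit, null open sets and reflection of Lebesgue measure\<close>

lemma Ray_iff: "p \<in> Ray \<longleftrightarrow> fst p = snd p \<and> 0 \<le> fst p"
  by (cases p) (auto simp: Ray_def)

lemma closed_Ray: "closed Ray"
proof -
  have "closed ({p. fst p = snd p} \<inter> {p. 0 \<le> fst p} :: (real \<times> real) set)"
    by (intro closed_Int closed_Collect_eq closed_Collect_le continuous_intros)
  also have "{p. fst p = snd p} \<inter> {p. 0 \<le> fst p} = Ray" by (auto simp: Ray_iff)
  finally show ?thesis .
qed

text \<open>Nonempty open sets are not negligible. Together with continuity this turns statements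
  that measure theory yields almost everywhere into statements at every point.\<close>

lemma open_null_empty:
  fixes S :: "'a::euclidean_space set"
  assumes "open S" "emeasure lborel S = 0"
  shows "S = {}"
proof (rule ccontr)
  assume "S \<noteq> {}"
  have "S \<in> null_sets lborel" using assms by (auto simp: null_sets_def)
  then have "negligible S" by (auto simp: negligible_iff_null_sets null_sets_completionI)
  then show False using open_not_negligible assms(1) \<open>S \<noteq> {}\<close> by blast
qed

lemma distr_swap_lborel: "distr lborel borel prod.swap = (lborel :: (real \<times> real) measure)"
proof -
  have "distr lborel borel prod.swap =
      distr (lborel \<Otimes>\<^sub>M lborel) (lborel \<Otimes>\<^sub>M (lborel :: real measure)) (\<lambda>(x::real, y). (y, x))"
    unfolding lborel_prod by (rule distr_cong) auto
  also have "\<dots> = lborel \<Otimes>\<^sub>M lborel" by (rule lborel_pair.distr_pair_swap[symmetric])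
  finally show ?thesis by (simp only: lborel_prod)
qed

lemma integral_swap_lborel:
  fixes h :: "real \<times> real \<Rightarrow> real"
  assumes "h \<in> borel_measurable borel"
  shows "(\<integral>x. h (prod.swap x) \<partial>lborel) = (\<integral>x. h x \<partial>lborel)"
proof -
  have "(\<integral>x. h x \<partial>lborel) = (\<integral>x. h x \<partial>distr lborel borel prod.swap)" by (simp add: distr_swap_lborel)
  also have "\<dots> = (\<integral>x. h (prod.swap x) \<partial>lborel)"
    by (rule integral_distr) (use assms in \<open>auto intro: borel_measurable_continuous_onI continuous_on_swap\<close>)
  finally show ?thesis ..
qed

subsection \<open>The gradient of the potential\<close>

text \<open>\<open>V\<close> and \<open>R\<close> stand for v and \<rho>. Being continuous
  extensions past the slit, they are parameters, tied to the derivatives of \<open>\<phi>\<close>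
  only in the interior and off \<open>Ray\<close>.\<close>

locale brenier =
  fixes \<phi> V R :: "real \<times> real \<Rightarrow> real"
  assumes convex: "convex_on Omega \<phi>"
    and smooth: "smooth_on (interior Omega - Ray) \<phi>"
    and MA: "\<forall>p\<in>interior Omega - Ray.
               px (px \<phi>) p * py (py \<phi>) p - (py (px \<phi>) p)\<^sup>2 = 1"
    and pushforward: "\<forall>B\<in>sets lborel.
        emeasure lborel {p \<in> interior Omega - Ray. (px \<phi> p, py \<phi> p) \<in> B}
          = emeasure lborel (Theta \<inter> B)"
    and V_cont: "continuous_on Omega V"
    and V_eq: "\<forall>p\<in>interior Omega - Ray. V p = px \<phi> p + py \<phi> p"
    and R_cont: "continuous_on (Omega - {(0, 0)}) R"
    and R_pos: "\<forall>p\<in>Omega - {(0, 0)}. R p > 0"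
    and R_eq: "\<forall>p\<in>interior Omega - Ray.
               R p = px (px \<phi>) p + 2 * py (px \<phi>) p + py (py \<phi>) p"
    and f_inj: "inj_on (\<lambda>p. (fst p - snd p, V p)) Omega"
    and f_origin: "V (0, 0) = 0"
begin

definition W where "W = interior Omega - Ray"

definition grad where "grad p = (px \<phi> p, py \<phi> p)"

lemma open_W: "open W"
  by (simp add: W_def open_Diff closed_Ray)

lemma W_subset_Omega: "W \<subseteq> Omega"
  using interior_subset by (auto simp: W_def)

lemma W_Omega: "p \<in> W \<Longrightarrow> p \<in> Omega"
  using W_subset_Omega by (rule subsetD)

lemma norm_W: "p \<in> W \<Longrightarrow> norm p \<le> 1"
  by (rule norm_Omega[OF W_Omega])

lemma swap_W: "p \<in> W \<Longrightarrow> prod.swap p \<in> W"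
  using swap_interior_Omega by (auto simp: W_def Ray_iff)

lemma C_k_\<phi>: "C_k k W \<phi>"
  using smooth by (simp add: smooth_on_def W_def)

lemma has_derivative_\<phi>: "p \<in> W \<Longrightarrow> (\<phi> has_derivative (\<lambda>k. grad p \<bullet> k)) (at p)"
  using C_k_\<phi>[of 1] by (auto simp: grad_def inner_prod_def dest!: bspec differentiable_px_py)

lemma differentiable_grad:
  "p \<in> W \<Longrightarrow> px \<phi> differentiable (at p)" "p \<in> W \<Longrightarrow> py \<phi> differentiable (at p)"
  using C_k_\<phi>[of 2] by (auto simp: numeral_2_eq_2)

lemma continuous_on_grad: "continuous_on W grad"
  unfolding grad_def
  by (intro continuous_on_Pair continuous_at_imp_continuous_on ballI
      differentiable_imp_continuous_within differentiable_grad)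

lemma continuous_on_\<phi>: "continuous_on W \<phi>"
  using C_k_\<phi>[of 0] by simp

text \<open>Convexity on the whole of \<open>Omega\<close> bounds every difference quotient from
  \<open>p\<close> towards \<open>q\<close> by \<open>\<phi> q - \<phi> p\<close>, and their limit
  is the directional derivative. The segment may cross the slit, and \<open>q\<close> may lie on it
  or on the boundary.\<close>

lemma tangent:
  assumes p: "p \<in> W" and q: "q \<in> Omega"
  shows "\<phi> q \<ge> \<phi> p + grad p \<bullet> (q - p)"
proof -
  have "((\<lambda>t. \<phi> (p + t *\<^sub>R (q - p))) has_derivative (\<lambda>t. grad p \<bullet> (t *\<^sub>R (q - p)))) (at 0)"
    by (rule has_derivative_compose[where g = \<phi> and f = "\<lambda>t. p + t *\<^sub>R (q - p)", simplified])
       (auto intro!: derivative_eq_intros has_derivative_\<phi> p)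
  then have "((\<lambda>t. \<phi> (p + t *\<^sub>R (q - p))) has_real_derivative (grad p \<bullet> (q - p))) (at 0)"
    by (simp add: has_field_derivative_def mult.commute[of _ "grad p \<bullet> (q - p)"] mult_commute_abs)
  then have lim: "((\<lambda>t. (\<phi> (p + t *\<^sub>R (q - p)) - \<phi> p) / t) \<longlongrightarrow> grad p \<bullet> (q - p)) (at_right 0)"
    by (auto simp: DERIV_def intro: tendsto_within_subset)
  have "\<forall>\<^sub>F t in at_right 0. (\<phi> (p + t *\<^sub>R (q - p)) - \<phi> p) / t \<le> \<phi> q - \<phi> p"
  proof -
    have "\<forall>\<^sub>F t in at_right 0. t \<in> {0<..<1::real}"
      by (rule eventually_at_right_real) simp
    then show ?thesis
    proof eventually_elim
      case (elim t)
      have "\<phi> ((1 - t) *\<^sub>R p + t *\<^sub>R q) \<le> (1 - t) * \<phi> p + t * \<phi> q"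
        using convex_onD[OF convex, of t p q] elim p q W_subset_Omega by auto
      then have "\<phi> (p + t *\<^sub>R (q - p)) - \<phi> p \<le> t * (\<phi> q - \<phi> p)"
        by (simp add: algebra_simps)
      then show ?case using elim by (simp add: field_simps)
    qed
  qed
  then have "grad p \<bullet> (q - p) \<le> \<phi> q - \<phi> p"
    by (rule tendsto_upperbound[OF lim]) simp
  then show ?thesis by simp
qed

lemma grad_monotone: "p \<in> W \<Longrightarrow> q \<in> W \<Longrightarrow> 0 \<le> (grad p - grad q) \<bullet> (p - q)"
  using tangent[OF _ W_Omega, of p q] tangent[OF _ W_Omega, of q p]
  by (simp add: inner_diff_left inner_diff_right)

lemma emeasure_grad_vimage:
  "B \<in> sets borel \<Longrightarrow> emeasure lborel {p \<in> W. grad p \<in> B} = emeasure lborel (Theta \<inter> B)"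
  using pushforward by (simp add: W_def grad_def)

text \<open>By the pushforward, the preimage of the complement of \<open>Theta\<close> is null. It
  is also open, as the gradient is continuous and \<open>Theta\<close> closed, hence empty.\<close>

lemma grad_in_Theta: "p \<in> W \<Longrightarrow> grad p \<in> Theta"
proof -
  have "open (- Theta)" using compact_imp_closed[OF compact_Theta] by auto
  then have "open {p \<in> W. grad p \<in> - Theta}"
    using continuous_open_preimage[OF continuous_on_grad open_W, of "- Theta"]
    by (simp add: vimage_def Int_def)
  moreover have "emeasure lborel {p \<in> W. grad p \<in> - Theta} = 0"
    using emeasure_grad_vimage[of "- Theta"] \<open>open (- Theta)\<close> by auto
  ultimately have "{p \<in> W. grad p \<in> - Theta} = {}" by (rule open_null_empty)
  then show "p \<in> W \<Longrightarrow> grad p \<in> Theta" by blast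
qed

lemma bounded_grad: "bounded (grad ` W)"
  using grad_in_Theta compact_imp_bounded[OF compact_Theta] by (auto intro: bounded_subset)

subsection \<open>Symmetry of the potential\<close>

lemma W_nonempty: "W \<noteq> {}"
proof -
  obtain e where e: "e > 0" "ball (0, 0) e \<subseteq> interior Omega"
    using origin_in_interior_Omega open_contains_ball open_interior by blast
  have "(- e/2, 0) \<in> W"
    using e by (auto simp: W_def Ray_iff dist_Pair_Pair intro!: subsetD[OF e(2)])
  then show ?thesis by blast
qed

text \<open>The tangent inequalities at a fixed \<open>p\<close> and at \<open>q\<close> bound
  \<open>\<phi> q - \<phi> p\<close> from both sides, the gradient being bounded. Segments need not
  stay inside \<open>W\<close>, because of the slit.\<close>

lemma bounded_\<phi>: "bounded (\<phi> ` W)"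
proof -
  obtain p where p: "p \<in> W" using W_nonempty by blast
  obtain K where K: "\<And>q. q \<in> W \<Longrightarrow> norm (grad q) \<le> K" using bounded_grad by (auto simp: bounded_iff)
  have "\<bar>\<phi> q\<bar> \<le> \<bar>\<phi> p\<bar> + K * 2" if q: "q \<in> W" for q
  proof -
    have n: "norm (q - p) \<le> 2" "norm (p - q) \<le> 2"
      using norm_triangle_ineq4[of q p] norm_triangle_ineq4[of p q] norm_W[OF p] norm_W[OF q] by linarith+
    have "\<bar>grad p \<bullet> (q - p)\<bar> \<le> K * 2" "\<bar>grad q \<bullet> (p - q)\<bar> \<le> K * 2"
      using Cauchy_Schwarz_ineq2[of "grad p" "q - p"] Cauchy_Schwarz_ineq2[of "grad q" "p - q"]
        mult_mono[OF K[OF p] n(1)] mult_mono[OF K[OF q] n(2)] K[OF p] norm_ge_zero[of "grad p"]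
      by (smt (verit) norm_ge_zero)+
    then show ?thesis using tangent[of p q] tangent[of q p] p q W_subset_Omega by (auto simp: abs_le_iff)
  qed
  then show ?thesis unfolding bounded_iff by (metis imageE real_norm_def)
qed

text \<open>Legendre transform of \<open>\<phi>\<close>, with the supremum over \<open>W\<close>,
  where the gradient is available.\<close>

definition conj where "conj \<xi> = (SUP x\<in>W. x \<bullet> \<xi> - \<phi> x)"

lemma bdd_above_conj: "bdd_above ((\<lambda>x. x \<bullet> \<xi> - \<phi> x) ` W)"
proof -
  obtain K where K: "\<And>q. q \<in> W \<Longrightarrow> \<bar>\<phi> q\<bar> \<le> K" using bounded_\<phi> by (auto simp: bounded_iff)
  have "x \<bullet> \<xi> - \<phi> x \<le> norm \<xi> + K" if "x \<in> W" for x
  proof -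
    have "norm x * norm \<xi> \<le> norm \<xi>" using norm_W[OF that]
      by (intro mult_left_le_one_le) auto
    then show ?thesis using norm_cauchy_schwarz[of x \<xi>] K[OF that] by linarith
  qed
  then show ?thesis by (rule bdd_aboveI2)
qed

lemma conj_ge: "x \<in> W \<Longrightarrow> x \<bullet> \<xi> - \<phi> x \<le> conj \<xi>"
  unfolding conj_def by (rule cSUP_upper[OF _ bdd_above_conj])

lemma conj_le: "(\<And>x. x \<in> W \<Longrightarrow> x \<bullet> \<xi> - \<phi> x \<le> c) \<Longrightarrow> conj \<xi> \<le> c"
  unfolding conj_def by (rule cSUP_least[OF W_nonempty])

lemma conj_grad: "x \<in> W \<Longrightarrow> conj (grad x) = x \<bullet> grad x - \<phi> x"
proof (rule antisym)
  assume x: "x \<in> W"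
  show "conj (grad x) \<le> x \<bullet> grad x - \<phi> x"
  proof (rule conj_le)
    fix y assume "y \<in> W"
    then show "y \<bullet> grad x - \<phi> y \<le> x \<bullet> grad x - \<phi> x"
      using tangent[OF x W_Omega, of y] by (simp add: inner_commute[of "grad x"] inner_diff_left)
  qed
qed (rule conj_ge)

text \<open>A supremum of affine functions is 1-Lipschitz if their slopes, here the points of
  \<open>W\<close>, have norm at most 1.\<close>

lemma continuous_on_conj: "continuous_on S conj"
proof -
  have "conj \<xi> \<le> conj \<eta> + norm (\<xi> - \<eta>)" for \<xi> \<eta>
  proof (rule conj_le)
    fix x assume x: "x \<in> W"
    have "norm x * norm (\<xi> - \<eta>) \<le> norm (\<xi> - \<eta>)" using norm_W[OF x]
      by (intro mult_left_le_one_le) auto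
    then have "x \<bullet> \<xi> \<le> x \<bullet> \<eta> + norm (\<xi> - \<eta>)"
      using norm_cauchy_schwarz[of x "\<xi> - \<eta>"] by (simp add: inner_diff_right)
    then show "x \<bullet> \<xi> - \<phi> x \<le> conj \<eta> + norm (\<xi> - \<eta>)" using conj_ge[OF x, of \<eta>] by linarith
  qed
  from this[of \<xi> \<eta> for \<xi> \<eta>] this[of \<eta> \<xi> for \<xi> \<eta>]
  have "dist (conj \<xi>) (conj \<eta>) \<le> 1 * dist \<xi> \<eta>" for \<xi> \<eta>
    unfolding dist_norm real_norm_def by (smt (verit) norm_minus_commute)
  then have "1-lipschitz_on S conj" by (intro lipschitz_onI) auto
  then show ?thesis by (rule lipschitz_on_continuous_on)
qed

section \<open>Integration over the slit domain and change of variables by the gradient\<close>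

lemma W_sets: "W \<in> sets borel" using open_W by auto

abbreviation \<mu> where "\<mu> \<equiv> restrict_space lborel W"

lemma space_\<mu>: "space \<mu> = W" by (simp add: space_restrict_space)

lemma finite_measure_\<mu>: "finite_measure \<mu>"
proof (rule finite_measureI)
  have "bounded W" using compact_imp_bounded[OF compact_Omega] W_subset_Omega bounded_subset by blast
  then have "emeasure lborel W < \<infinity>" by (rule emeasure_bounded_finite)
  then show "emeasure \<mu> (space \<mu>) \<noteq> \<infinity>"
    using W_sets by (simp add: space_\<mu> emeasure_restrict_space)
qed

lemma measurable_\<mu>: "continuous_on W g \<Longrightarrow> g \<in> borel_measurable \<mu>"
  using borel_measurable_continuous_on_restrict[of W g]
  by (simp cong: measurable_cong_sets add: sets_restrict_space_cong[OF sets_lborel])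

lemma integrable_\<mu>:
  fixes g :: "real \<times> real \<Rightarrow> real"
  assumes "continuous_on W g" "bounded (g ` W)"
  shows "integrable \<mu> g"
proof -
  interpret finite_measure \<mu> by (rule finite_measure_\<mu>)
  obtain K where "\<And>x. x \<in> W \<Longrightarrow> norm (g x) \<le> K" using assms(2) by (auto simp: bounded_iff)
  then show ?thesis
    by (intro integrable_const_bound[of _ K] measurable_\<mu> assms(1) AE_I2) (simp add: space_\<mu>)
qed

lemma integral_\<mu>_swap:
  fixes g :: "real \<times> real \<Rightarrow> real"
  assumes "continuous_on W g"
  shows "(\<integral>x. g (prod.swap x) \<partial>\<mu>) = (\<integral>x. g x \<partial>\<mu>)"
proof -
  have sw: "prod.swap x \<in> W \<longleftrightarrow> x \<in> W" for x using swap_W by fastforce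
  let ?h = "\<lambda>x. indicator W x *\<^sub>R g x"
  have "(\<integral>x. g (prod.swap x) \<partial>\<mu>) = (\<integral>x. ?h (prod.swap x) \<partial>lborel)"
    using W_sets by (subst integral_restrict_space) (auto simp: indicator_def sw)
  also have "\<dots> = (\<integral>x. ?h x \<partial>lborel)"
    by (rule integral_swap_lborel) (rule borel_measurable_continuous_on_indicator[OF W_sets assms])
  also have "\<dots> = (\<integral>x. g x \<partial>\<mu>)" using W_sets by (subst integral_restrict_space) auto
  finally show ?thesis .
qed

lemma Theta_sets: "Theta \<in> sets borel"
  using compact_imp_closed[OF compact_Theta] by auto

lemma distr_grad: "distr \<mu> borel grad = density lborel (indicator Theta)"
proof (rule measure_eqI)
  fix B assume "B \<in> sets (distr \<mu> borel grad)"
  then have B: "B \<in> sets borel" by simp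
  have "emeasure (distr \<mu> borel grad) B = emeasure \<mu> (grad -` B \<inter> W)"
    using emeasure_distr[OF measurable_\<mu>[OF continuous_on_grad] B] by (simp add: space_\<mu>)
  also have "\<dots> = emeasure lborel {p \<in> W. grad p \<in> B}"
    using W_sets by (subst emeasure_restrict_space) (auto intro!: arg_cong[where f = "emeasure lborel"])
  also have "\<dots> = emeasure lborel (Theta \<inter> B)" by (rule emeasure_grad_vimage[OF B])
  also have "\<dots> = emeasure (density lborel (indicator Theta)) B"
    using B Theta_sets by (subst emeasure_density) (auto simp: indicator_inter_arith[symmetric])
  finally show "emeasure (distr \<mu> borel grad) B = emeasure (density lborel (indicator Theta)) B" .
qed simp

lemma integral_grad:
  fixes h :: "real \<times> real \<Rightarrow> real"
  assumes "h \<in> borel_measurable borel"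
  shows "(\<integral>x. h (grad x) \<partial>\<mu>) = (\<integral>y. indicator Theta y * h y \<partial>lborel)"
proof -
  have "(\<integral>x. h (grad x) \<partial>\<mu>) = (\<integral>y. h y \<partial>distr \<mu> borel grad)"
    by (rule integral_distr[symmetric]) (use assms measurable_\<mu>[OF continuous_on_grad] in auto)
  also have "\<dots> = (\<integral>y. h y \<partial>density lborel (\<lambda>y. ennreal (indicator Theta y)))"
    by (simp add: distr_grad ennreal_indicator)
  also have "\<dots> = (\<integral>y. indicator Theta y *\<^sub>R h y \<partial>lborel)"
    by (rule integral_density) (use assms Theta_sets in auto)
  finally show ?thesis by simp
qed

text \<open>Both Lebesgue measure and \<open>Theta\<close> are invariant under the reflection, and
  so is the law of the gradient.\<close>

lemma integral_grad_swap:
  fixes h :: "real \<times> real \<Rightarrow> real"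
  assumes "h \<in> borel_measurable borel"
  shows "(\<integral>x. h (prod.swap (grad x)) \<partial>\<mu>) = (\<integral>x. h (grad x) \<partial>\<mu>)"
proof -
  have sw: "indicator Theta (prod.swap y) = (indicator Theta y :: real)" for y
    using swap_Theta[of y] swap_Theta[of "prod.swap y"] by (auto simp: indicator_def)
  have m: "(\<lambda>y. h (prod.swap y)) \<in> borel_measurable borel"
    by (rule measurable_compose[OF borel_measurable_continuous_onI[OF continuous_on_swap] assms])
  have "(\<integral>x. h (prod.swap (grad x)) \<partial>\<mu>) = (\<integral>y. indicator Theta (prod.swap y) * h (prod.swap y) \<partial>lborel)"
    unfolding sw by (rule integral_grad[OF m])
  also have "\<dots> = (\<integral>y. indicator Theta y * h y \<partial>lborel)"
    by (rule integral_swap_lborel) (use assms Theta_sets in auto)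
  also have "\<dots> = (\<integral>x. h (grad x) \<partial>\<mu>)" by (rule integral_grad[OF assms, symmetric])
  finally show ?thesis .
qed

text \<open>The reflected potential is optimal for the same transport problem, so duality forces
  equality in its Fenchel--Young inequality along the gradient of the original one.\<close>

lemma grad_swap:
  assumes p: "p \<in> W"
  shows "grad (prod.swap p) = prod.swap (grad p)"
proof -
  \<comment> \<open>The Fenchel--Young defect of \<open>\<phi>\<close> at the reflected point and
    the reflected gradient; reflecting both leaves their inner product unchanged.\<close>
  let ?g = "\<lambda>x. \<phi> (prod.swap x) + conj (prod.swap (grad x)) - x \<bullet> grad x"
  have inner_swap: "prod.swap x \<bullet> prod.swap y = x \<bullet> y" for x y :: "real \<times> real"
    by (cases x; cases y) simp
  have nonneg: "0 \<le> ?g x" if "x \<in> W" for x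
    using conj_ge[OF swap_W[OF that], of "prod.swap (grad x)"] by (simp add: inner_swap)
  have c1: "continuous_on W (\<lambda>x. \<phi> (prod.swap x))"
    by (rule continuous_on_compose2[OF continuous_on_\<phi> continuous_on_swap]) (use swap_W in auto)
  have c2: "continuous_on W (\<lambda>x. conj (prod.swap (grad x)))"
    by (rule continuous_on_compose2[OF continuous_on_conj continuous_on_compose2[OF continuous_on_swap continuous_on_grad]]) auto
  have c3: "continuous_on W (\<lambda>x. x \<bullet> grad x)"
    by (intro continuous_intros continuous_on_grad)
  have c4: "continuous_on W (\<lambda>x. conj (grad x))"
    by (rule continuous_on_compose2[OF continuous_on_conj continuous_on_grad]) auto
  have cg: "continuous_on W ?g" by (intro continuous_intros c1 c2 c3)
  have bconj: "bounded (conj ` Theta)"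
    by (intro compact_imp_bounded compact_continuous_image continuous_on_conj compact_Theta)
  have b1: "bounded ((\<lambda>x. \<phi> (prod.swap x)) ` W)"
    by (rule bounded_subset[OF bounded_\<phi>]) (use swap_W in auto)
  have b2: "bounded ((\<lambda>x. conj (prod.swap (grad x))) ` W)"
    by (rule bounded_subset[OF bconj]) (use swap_Theta[OF grad_in_Theta] in blast)
  have b4: "bounded ((\<lambda>x. conj (grad x)) ` W)"
    by (rule bounded_subset[OF bconj]) (use grad_in_Theta in auto)
  have "x \<bullet> grad x = conj (grad x) + \<phi> x" if "x \<in> W" for x using conj_grad[OF that] by simp
  then have "(\<lambda>x. x \<bullet> grad x) ` W = (\<lambda>x. conj (grad x) + \<phi> x) ` W" by (rule image_cong[OF refl])
  then have b3: "bounded ((\<lambda>x. x \<bullet> grad x) ` W)"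
    using bounded_plus_comp[OF b4 bounded_\<phi>] by simp
  note int = integrable_\<mu>[OF c1 b1] integrable_\<mu>[OF c2 b2] integrable_\<mu>[OF c3 b3]
    integrable_\<mu>[OF c4 b4] integrable_\<mu>[OF continuous_on_\<phi> bounded_\<phi>]
  have "(\<integral>x. ?g x \<partial>\<mu>) = (\<integral>x. \<phi> (prod.swap x) \<partial>\<mu>) + (\<integral>x. conj (prod.swap (grad x)) \<partial>\<mu>) - (\<integral>x. x \<bullet> grad x \<partial>\<mu>)"
    using int by simp
  \<comment> \<open>Each reflected integral equals the unreflected one, by the symmetry of
    \<open>Omega\<close> and of \<open>Theta\<close>; the unreflected defect vanishes identically by
    \<open>conj_grad\<close>.\<close>
  also have "\<dots> = (\<integral>x. \<phi> x \<partial>\<mu>) + (\<integral>x. conj (grad x) \<partial>\<mu>) - (\<integral>x. x \<bullet> grad x \<partial>\<mu>)"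
    using integral_\<mu>_swap[OF continuous_on_\<phi>]
      integral_grad_swap[OF borel_measurable_continuous_onI[OF continuous_on_conj]] by simp
  also have "\<dots> = (\<integral>x. \<phi> x + conj (grad x) - x \<bullet> grad x \<partial>\<mu>)" using int by simp
  also have "\<dots> = (\<integral>x. 0 \<partial>\<mu>)"
    by (rule Bochner_Integration.integral_cong) (auto simp: space_\<mu> conj_grad)
  finally have zero: "(\<integral>x. ?g x \<partial>\<mu>) = 0" by simp
  \<comment> \<open>The defect is nonnegative with integral 0, hence 0 almost everywhere; its
    continuity then makes it vanish at every point of \<open>W\<close>.\<close>
  have "AE x in \<mu>. ?g x = 0"
    using zero int nonneg by (subst integral_nonneg_eq_0_iff_AE[symmetric]) (auto simp: space_\<mu>)
  then have "AE x in lborel. x \<in> W \<longrightarrow> ?g x = 0"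
    using W_sets by (simp add: AE_restrict_space_iff)
  then have "AE x in lborel. \<not> (x \<in> W \<and> ?g x \<in> - {0})"
    by eventually_elim simp
  then have null: "emeasure lborel {x \<in> W. ?g x \<in> - {0}} = 0"
    using emeasure_eq_0_AE[where M = lborel and P = "\<lambda>x. x \<in> W \<and> ?g x \<in> - {0}"] by simp
  have op: "open {x \<in> W. ?g x \<in> - {0}}"
    using continuous_open_preimage[OF cg open_W, of "- {0}"]
    by (simp add: vimage_def Int_def open_Compl)
  have "{x \<in> W. ?g x \<in> - {0}} = {}" by (rule open_null_empty[OF op null])
  then have "?g p \<notin> - {0}" using p by blast
  then have eq: "conj (prod.swap (grad p)) = p \<bullet> grad p - \<phi> (prod.swap p)" by simp
  \<comment> \<open>Zero defect says that this function of \<open>y\<close> attains its maximum over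
    \<open>W\<close> at \<open>prod.swap p\<close>, so its derivative vanishes there, which
    identifies the gradient.\<close>
  have "((\<lambda>y. y \<bullet> prod.swap (grad p) - \<phi> y) has_derivative
      (\<lambda>k. k \<bullet> prod.swap (grad p) - grad (prod.swap p) \<bullet> k)) (at (prod.swap p))"
    by (intro has_derivative_diff bounded_linear_imp_has_derivative[OF bounded_linear_inner_left]
        has_derivative_\<phi> swap_W p)
  moreover have "\<forall>y\<in>W. y \<bullet> prod.swap (grad p) - \<phi> y \<le> prod.swap p \<bullet> prod.swap (grad p) - \<phi> (prod.swap p)"
    using conj_ge[of _ "prod.swap (grad p)"] by (simp add: eq inner_swap)
  ultimately have "(\<lambda>k. k \<bullet> prod.swap (grad p) - grad (prod.swap p) \<bullet> k) = (\<lambda>k. 0)"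
    by (intro differential_zero_maxmin[OF swap_W[OF p] open_W]) auto
  from fun_cong[OF this] have "k \<bullet> grad (prod.swap p) = k \<bullet> prod.swap (grad p)" for k
    by (metis diff_eq_diff_eq eq_iff_diff_eq_0 inner_commute)
  then show ?thesis by (metis vector_eq_ldot)
qed

end

text \<open>The map from (v, d) to (v / 2 + d, v / 2 - d) has Jacobian of modulus 1; it is split
  into a shear in the second coordinate and, for fixed v, a translation. Here v is the coordinate
  sum and d half the difference.\<close>

lemma nn_integral_lborel_rotated:
  fixes h :: "real \<times> real \<Rightarrow> ennreal"
  assumes [measurable]: "h \<in> borel_measurable borel"
  shows "(\<integral>\<^sup>+x. h x \<partial>lborel) = (\<integral>\<^sup>+v. \<integral>\<^sup>+d. h (v / 2 + d, v / 2 - d) \<partial>lborel \<partial>lborel)"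
proof -
  have m: "h \<in> borel_measurable (lborel \<Otimes>\<^sub>M lborel)" unfolding lborel_prod by simp
  have "(\<integral>\<^sup>+x. h x \<partial>lborel) = (\<integral>\<^sup>+p. \<integral>\<^sup>+q. h (p, q) \<partial>lborel \<partial>lborel)"
    unfolding lborel_prod[symmetric] by (rule lborel.nn_integral_fst[OF m, symmetric])
  also have "\<dots> = (\<integral>\<^sup>+p. \<integral>\<^sup>+v. h (p, v - p) \<partial>lborel \<partial>lborel)"
  proof (rule nn_integral_cong)
    fix p :: real
    show "(\<integral>\<^sup>+q. h (p, q) \<partial>lborel) = (\<integral>\<^sup>+v. h (p, v - p) \<partial>lborel)"
      by (subst nn_integral_real_affine[of _ 1 "- p"]) auto
  qed
  also have "\<dots> = (\<integral>\<^sup>+v. \<integral>\<^sup>+p. h (p, v - p) \<partial>lborel \<partial>lborel)"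
    by (rule lborel_pair.Fubini'[symmetric]) (simp add: lborel_prod borel_prod[symmetric])
  also have "\<dots> = (\<integral>\<^sup>+v. \<integral>\<^sup>+d. h (v / 2 + d, v / 2 - d) \<partial>lborel \<partial>lborel)"
  proof (rule nn_integral_cong)
    fix v :: real
    show "(\<integral>\<^sup>+p. h (p, v - p) \<partial>lborel) = (\<integral>\<^sup>+d. h (v / 2 + d, v / 2 - d) \<partial>lborel)"
      by (subst nn_integral_real_affine[of _ 1 "v / 2"]) auto
  qed
  finally show ?thesis .
qed

text \<open>The slit has empty interior: of \<open>w\<close> and a point slightly above it, at least
  one is off the slit.\<close>

lemma open_contains_nonreal:
  fixes U :: "complex set"
  assumes "open U" "w \<in> U"
  obtains z where "z \<in> U" "z \<notin> \<real>\<^sub>\<ge>\<^sub>0"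
proof -
  obtain e where e: "e > 0" "cball w e \<subseteq> U" using assms open_contains_cball by blast
  have "w + \<i> * of_real e \<in> U" using e by (auto intro!: subsetD[OF e(2)] simp: dist_norm norm_mult)
  moreover have "w \<notin> \<real>\<^sub>\<ge>\<^sub>0 \<or> w + \<i> * of_real e \<notin> \<real>\<^sub>\<ge>\<^sub>0"
    using e by (auto simp: complex_nonneg_Reals_iff)
  ultimately show ?thesis using that assms by blast
qed

lemma continuous_eq_across_slit:
  fixes g h :: "complex \<Rightarrow> 'a::real_normed_vector"
  assumes U: "open U" and g: "continuous_on U g" and h: "continuous_on U h"
    and eq: "\<And>w. w \<in> U - \<real>\<^sub>\<ge>\<^sub>0 \<Longrightarrow> g w = h w" and w: "w \<in> U"
  shows "g w = h w"
proof (rule ccontr)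
  assume ne: "g w \<noteq> h w"
  have "open {z \<in> U. g z - h z \<in> - {0}}"
    using continuous_open_preimage[OF continuous_on_diff[OF g h] U, of "- {0}"]
    by (simp add: vimage_def Int_def open_Compl)
  then obtain z where "z \<in> {z \<in> U. g z - h z \<in> - {0}}" "z \<notin> \<real>\<^sub>\<ge>\<^sub>0"
    using open_contains_nonreal[of _ w] w ne by (metis (no_types, lifting) ComplI eq_iff_diff_eq_0 mem_Collect_eq singletonD)
  then show False using eq by auto
qed

context brenier
begin

subsection \<open>The conformal coordinate\<close>

definition T where "T p = cplx (fst p - snd p, V p)"

text \<open>The inverse is taken on all of \<open>Omega\<close> rather than on the interior, so that
  compactness yields its continuity.\<close>

definition X where "X = the_inv_into Omega T"

definition S where "S = T ` interior Omega"

definition cross where "cross p = (px \<phi> p - py \<phi> p) / 2"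

definition F where "F w = Complex ((fst (X w) + snd (X w)) / 2) (cross (X w))"

lemma V_grad: "p \<in> W \<Longrightarrow> V p = fst (grad p) + snd (grad p)"
  using V_eq by (simp add: W_def grad_def)

lemma Re_T: "Re (T p) = V p" and Im_T: "Im (T p) = fst p - snd p"
  by (simp_all add: T_def)

lemma inj_T: "inj_on T Omega"
  using f_inj by (auto simp: inj_on_def T_def cplx_def)

lemma continuous_on_T: "continuous_on Omega T"
  unfolding T_def
  by (rule continuous_on_compose2[OF continuous_on_cplx[of UNIV]]) (auto intro!: continuous_intros V_cont)

lemma X_T [simp]: "p \<in> Omega \<Longrightarrow> X (T p) = p"
  unfolding X_def by (rule the_inv_into_f_f[OF inj_T])

lemma continuous_on_X: "continuous_on (T ` Omega) X"
  by (rule continuous_on_inv[OF continuous_on_T compact_Omega]) simp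

lemma S_subset: "S \<subseteq> T ` Omega"
  unfolding S_def using interior_subset by blast

lemma open_T_image: "open A \<Longrightarrow> A \<subseteq> Omega \<Longrightarrow> open (T ` A)"
  by (rule invariance_of_domain_gen)
     (auto intro: continuous_on_subset[OF continuous_on_T] inj_on_subset[OF inj_T])

lemma open_S: "open S"
  unfolding S_def by (rule open_T_image[OF open_interior interior_subset])

text \<open>Invariance of domain is applied to the inverse \<open>X\<close> as well: it carries the
  interior of the image into the interior of \<open>Omega\<close>, so no boundary point of
  \<open>Omega\<close> lands inside.\<close>

lemma interior_T_image: "interior (T ` Omega) = S"
proof
  let ?I = "interior (T ` Omega)"
  have "open (X ` ?I)"
  proof (rule invariance_of_domain_gen)
    show "continuous_on ?I X" using continuous_on_X interior_subset by (rule continuous_on_subset)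
    have "inj_on X (T ` Omega)" by (auto simp: inj_on_def)
    then show "inj_on X ?I" using interior_subset by (rule inj_on_subset)
  qed auto
  moreover have "X ` ?I \<subseteq> Omega" using interior_subset[of "T ` Omega"] by force
  ultimately have "X ` ?I \<subseteq> interior Omega" by (rule interior_maximal[rotated])
  moreover have "w = T (X w)" if "w \<in> ?I" for w
    using that interior_subset[of "T ` Omega"] by force
  ultimately show "?I \<subseteq> S" unfolding S_def by blast
qed (rule interior_maximal[OF S_subset open_S])

lemma T_origin: "T (0, 0) = 0"
  by (simp add: complex_eq_iff Re_T Im_T f_origin)

lemma zero_in_S: "0 \<in> S"
  unfolding S_def using origin_in_interior_Omega T_origin by force

text \<open>On the slit no gradient is at hand, so both points are shifted off the diagonal by (e,
  -e). Their displacement stays a multiple of (1, 1), hence monotonicity of the gradient compares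
  the values of \<open>V\<close>. The limit loses strictness, which injectivity restores.\<close>

lemma V_diagonal_mono:
  assumes a: "(a, a) \<in> interior Omega" and b: "(b, b) \<in> interior Omega" and ab: "a < b"
  shows "V (a, a) < V (b, b)"
proof -
  define e where "e n = inverse (real (Suc n))" for n
  have e: "e \<longlonglongrightarrow> 0" unfolding e_def by (rule LIMSEQ_inverse_real_of_nat)
  have lim: "(\<lambda>n. (c + e n, c - e n)) \<longlonglongrightarrow> (c, c)" for c
    using tendsto_Pair[OF tendsto_add[OF tendsto_const e] tendsto_diff[OF tendsto_const e], of c c] by simp
  have ev: "\<forall>\<^sub>F n in sequentially. (c + e n, c - e n) \<in> W" if "(c, c) \<in> interior Omega" for c
  proof -
    have "\<forall>\<^sub>F n in sequentially. (c + e n, c - e n) \<in> interior Omega"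
      by (rule topological_tendstoD[OF lim open_interior that])
    then show ?thesis
    proof eventually_elim
      case (elim n)
      have "e n > 0" by (simp add: e_def)
      then show ?case using elim by (auto simp: W_def Ray_iff)
    qed
  qed
  have limV: "(\<lambda>n. V (c + e n, c - e n)) \<longlonglongrightarrow> V (c, c)" if c: "(c, c) \<in> interior Omega" for c
  proof (rule continuous_on_tendsto_compose[OF V_cont lim])
    show "(c, c) \<in> Omega" using c interior_subset by blast
    show "\<forall>\<^sub>F n in sequentially. (c + e n, c - e n) \<in> Omega"
      using ev[OF c] by eventually_elim (rule W_Omega)
  qed
  have "\<forall>\<^sub>F n in sequentially. V (a + e n, a - e n) \<le> V (b + e n, b - e n)"
    using ev[OF a] ev[OF b]
  proof eventually_elim
    case (elim n)
    have "0 \<le> (b - a) * (V (b + e n, b - e n) - V (a + e n, a - e n))"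
      using grad_monotone[OF elim(2) elim(1)]
      by (simp add: V_grad[OF elim(1)] V_grad[OF elim(2)] inner_prod_def algebra_simps)
    then show ?case using ab by (simp add: zero_le_mult_iff)
  qed
  then have "V (a, a) \<le> V (b, b)"
    using tendsto_le[OF sequentially_bot limV[OF b] limV[OF a]] by blast
  moreover have "V (a, a) \<noteq> V (b, b)"
  proof
    assume "V (a, a) = V (b, b)"
    moreover have "(a, a) \<in> Omega" "(b, b) \<in> Omega" using a b interior_subset by blast+
    ultimately have "(a, a) = (b, b)"
      using inj_onD[OF f_inj, of "(a, a)" "(b, b)"] by simp
    then show False using ab by simp
  qed
  ultimately show ?thesis by simp
qed

text \<open>Since \<open>Im (T p)\<close> is x - y, only the diagonal has real image, and along it
  \<open>V\<close> is strictly increasing with value 0 at the origin.\<close>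

lemma T_slit_iff:
  assumes p: "p \<in> interior Omega"
  shows "T p \<in> \<real>\<^sub>\<ge>\<^sub>0 \<longleftrightarrow> p \<in> Ray"
proof (cases "fst p = snd p")
  case True
  define a where "a = fst p"
  have pa: "p = (a, a)" using True by (simp add: a_def prod_eq_iff)
  have "0 \<le> V (a, a) \<longleftrightarrow> 0 \<le> a"
    using V_diagonal_mono[of a 0] V_diagonal_mono[of 0 a] origin_in_interior_Omega p f_origin
    unfolding pa by (cases a "0 :: real" rule: linorder_cases) auto
  then show ?thesis by (simp add: complex_nonneg_Reals_iff Ray_iff Re_T Im_T pa)
next
  case False
  then show ?thesis by (simp add: complex_nonneg_Reals_iff Ray_iff Im_T)
qed

lemma T_image_W: "T ` W = S - \<real>\<^sub>\<ge>\<^sub>0"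
  unfolding S_def W_def using T_slit_iff by blast

lemma X_in_W: "w \<in> S - \<real>\<^sub>\<ge>\<^sub>0 \<Longrightarrow> X w \<in> W"
  unfolding T_image_W[symmetric] using X_T[OF W_Omega] by force

lemma T_X: "w \<in> T ` Omega \<Longrightarrow> T (X w) = w"
  by (metis X_T imageE)

lemma T_swap: "p \<in> W \<Longrightarrow> T (prod.swap p) = cnj (T p)"
proof -
  assume p: "p \<in> W"
  have "V (prod.swap p) = V p"
    using grad_swap[OF p] by (simp add: V_grad[OF p] V_grad[OF swap_W[OF p]] add.commute)
  then show ?thesis by (simp add: complex_eq_iff Re_T Im_T)
qed

text \<open>Exchanging x and y fixes v and s and changes the sign of u and d, which is complex
  conjugation of both w and \<open>F\<close>.\<close>

lemma F_cnj:
  assumes "w \<in> S - \<real>\<^sub>\<ge>\<^sub>0" shows "F (cnj w) = cnj (F w)"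
proof -
  obtain p where p: "p \<in> W" "w = T p" using assms unfolding T_image_W[symmetric] by blast
  have "X (cnj w) = prod.swap p" using X_T[OF W_Omega[OF swap_W[OF p(1)]]] T_swap[OF p(1)] p by simp
  moreover have "X w = p" using p W_Omega by simp
  moreover have "cross (prod.swap p) = - cross p"
    using grad_swap[OF p(1)] by (simp add: cross_def grad_def field_simps)
  ultimately show ?thesis by (simp add: F_def complex_eq_iff add.commute)
qed

text \<open>The derivative of \<open>F\<close> is that of (s, d) composed with the inverse of the
  derivative of \<open>T\<close>. The result is multiplication by a complex number because the
  Hessian determinant is 1.\<close>

lemma F_derivative:
  assumes p: "p \<in> W"
  shows "(F has_field_derivative Complex (1 / R p) ((px (px \<phi>) p - py (py \<phi>) p) / 2 / R p)) (at (T p))"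
proof -
  define A B C where "A = px (px \<phi>) p" and "B = py (px \<phi>) p" and "C = py (py \<phi>) p"
  have MA': "A * C - B\<^sup>2 = 1" using MA p by (simp add: W_def A_def B_def C_def)
  have R: "R p = A + 2 * B + C" using R_eq p by (simp add: W_def A_def B_def C_def)
  have "p \<noteq> (0, 0)" using p by (auto simp: W_def Ray_iff)
  then have Rpos: "R p > 0" using R_pos W_Omega[OF p] by simp
  have D1: "(px \<phi> has_derivative (\<lambda>k. A * fst k + B * snd k)) (at p)"
    unfolding A_def B_def by (rule differentiable_px_py[OF differentiable_grad(1)[OF p]])
  have D2: "(py \<phi> has_derivative (\<lambda>k. B * fst k + C * snd k)) (at p)"
    using differentiable_px_py[OF differentiable_grad(2)[OF p]] px_py_commute[OF open_W C_k_\<phi> p]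
    by (simp add: B_def C_def)
  have "((\<lambda>q. px \<phi> q + py \<phi> q) has_derivative (\<lambda>k. (A + B) * fst k + (B + C) * snd k)) (at p)"
    by (rule has_derivative_eq_rhs[OF has_derivative_add[OF D1 D2]]) (auto simp: algebra_simps)
  then have DV: "(V has_derivative (\<lambda>k. (A + B) * fst k + (B + C) * snd k)) (at p)"
    by (rule has_derivative_transform_within_open[OF _ open_W p]) (use V_eq in \<open>auto simp: W_def\<close>)
  define T' where "T' k = cplx (fst k - snd k, (A + B) * fst k + (B + C) * snd k)" for k :: "real \<times> real"
  \<comment> \<open>Cramer's rule for \<open>T'\<close>: the Jacobian determinant of (u, v) with
    respect to (x, y) is A + 2 B + C, that is, \<open>R p\<close>.\<close>
  define X' where "X' w = ((Re w + (B + C) * Im w) / R p, (Re w - (A + B) * Im w) / R p)" for w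
  have DT: "(T has_derivative T') (at p)"
    unfolding T_def T'_def
    by (rule bounded_linear.has_derivative[OF bounded_linear_cplx])
       (auto intro!: derivative_eq_intros DV)
  have XT: "X (T p) = p" using W_Omega[OF p] by simp
  have "linear X'"
    by (rule linearI) (auto simp: X'_def add_divide_distrib diff_divide_distrib algebra_simps)
  then have X'bl: "bounded_linear X'" by (simp add: linear_conv_bounded_linear)
  have "X' (T' k) = k" for k
    using Rpos by (auto simp: X'_def T'_def R prod_eq_iff field_simps)
  then have X'T': "X' \<circ> T' = id" by auto
  have TW: "T p \<in> T ` W" using p by simp
  have oTW: "open (T ` W)" by (rule open_T_image[OF open_W W_subset_Omega])
  have DX: "(X has_derivative X') (at (T p))"
  proof (rule has_derivative_inverse_basic[OF _ X'bl X'T' _ oTW TW])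
    show "(T has_derivative T') (at (X (T p)))" using DT XT by simp
    show "continuous (at (T p)) X"
      using continuous_on_subset[OF continuous_on_X image_mono[OF W_subset_Omega]] TW
      by (simp only: continuous_on_eq_continuous_at[OF oTW])
    show "T (X z) = z" if "z \<in> T ` W" for z using that W_Omega by auto
  qed
  define G where "G q = Complex ((fst q + snd q) / 2) (cross q)" for q :: "real \<times> real"
  define G' where "G' k = Complex ((fst k + snd k) / 2) (((A - B) * fst k + (B - C) * snd k) / 2)" for k :: "real \<times> real"
  have DG: "(G has_derivative G') (at p)"
  proof -
    have G_alt: "G = (\<lambda>q. cplx (cross q, (fst q + snd q) / 2))" and
      G'_alt: "G' = (\<lambda>k. cplx (((A - B) * fst k + (B - C) * snd k) / 2, (fst k + snd k) / 2))"
      by (auto simp: G_def G'_def cplx_def)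
    have "(cross has_derivative (\<lambda>k. ((A - B) * fst k + (B - C) * snd k) / 2)) (at p)"
      unfolding cross_def
      by (rule has_derivative_eq_rhs[OF bounded_linear.has_derivative[OF bounded_linear_divide has_derivative_diff[OF D1 D2]]])
         (auto simp: algebra_simps)
    then show ?thesis
      unfolding G_alt G'_alt
      by (intro bounded_linear.has_derivative[OF bounded_linear_cplx] has_derivative_Pair)
         (auto intro!: derivative_eq_intros)
  qed
  have "((\<lambda>w. G (X w)) has_derivative (\<lambda>w. G' (X' w))) (at (T p))"
    by (rule has_derivative_compose[OF DX]) (simp add: XT DG)
  moreover have "(\<lambda>w. G (X w)) = F" by (auto simp: G_def F_def)
  moreover have "G' (X' w) = Complex (1 / R p) ((A - C) / 2 / R p) * w" for w
  proof -
    have scale: "(a * (x / r) + b * (y / r)) / 2 = (a * x + b * y) / r / 2" for a b x y r :: real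
      by (simp add: add_divide_distrib)
    \<comment> \<open>The Monge--Ampere equation turns the last coefficient into 2; then both
      diagonal entries equal \<open>1 / R p\<close>, and the Cauchy--Riemann equations hold.\<close>
    have "(A - B) * (Re w + (B + C) * Im w) + (B - C) * (Re w - (A + B) * Im w)
        = (A - C) * Re w + 2 * (A * C - B\<^sup>2) * Im w"
      by (simp add: algebra_simps power2_eq_square)
    then have i: "(A - B) * (Re w + (B + C) * Im w) + (B - C) * (Re w - (A + B) * Im w) = (A - C) * Re w + 2 * Im w"
      by (simp add: MA')
    have "Im (G' (X' w)) = ((A - B) * (Re w + (B + C) * Im w) + (B - C) * (Re w - (A + B) * Im w)) / R p / 2"
      by (simp only: G'_def X'_def complex.sel fst_conv snd_conv scale)
    also have "\<dots> = (A - C) / 2 / R p * Re w + 1 / R p * Im w"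
      unfolding i by (simp add: add_divide_distrib)
    finally have "Im (G' (X' w)) = (A - C) / 2 / R p * Re w + 1 / R p * Im w" .
    moreover have "Re (G' (X' w)) = 1 / R p * Re w - (A - C) / 2 / R p * Im w"
      using Rpos by (simp add: G'_def X'_def field_simps)
    ultimately show ?thesis by (simp add: complex_eq_iff algebra_simps)
  qed
  ultimately show ?thesis
    by (simp add: has_field_derivative_def A_def C_def)
qed

lemma F_holomorphic: "F holomorphic_on (S - \<real>\<^sub>\<ge>\<^sub>0)"
  unfolding T_image_W[symmetric] holomorphic_on_open[OF open_T_image[OF open_W W_subset_Omega]]
  using F_derivative by blast

lemma Re_deriv_F: "w \<in> S - \<real>\<^sub>\<ge>\<^sub>0 \<Longrightarrow> Re (deriv F w) = 1 / R (X w)"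
proof -
  assume "w \<in> S - \<real>\<^sub>\<ge>\<^sub>0"
  then obtain p where "p \<in> W" "w = T p" unfolding T_image_W[symmetric] by blast
  then show ?thesis using DERIV_imp_deriv[OF F_derivative] W_Omega by simp
qed

lemma bounded_F: "\<exists>K. \<forall>w\<in>S - \<real>\<^sub>\<ge>\<^sub>0. norm (F w) \<le> K"
proof -
  obtain K where K: "\<And>q. q \<in> W \<Longrightarrow> norm (grad q) \<le> K" using bounded_grad by (auto simp: bounded_iff)
  have "norm (F w) \<le> 1 + K" if "w \<in> S - \<real>\<^sub>\<ge>\<^sub>0" for w
  proof -
    have x: "X w \<in> W" by (rule X_in_W[OF that])
    have "\<bar>(fst (X w) + snd (X w)) / 2\<bar> \<le> 1" using Omega_bounds[OF W_Omega[OF x]] by auto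
    moreover have "\<bar>cross (X w)\<bar> \<le> K"
      using K[OF x] norm_fst_le[of "px \<phi> (X w)" "py \<phi> (X w)"] norm_snd_le[of "py \<phi> (X w)" "px \<phi> (X w)"]
      by (simp add: cross_def grad_def)
    ultimately show ?thesis using cmod_le[of "F w"] by (simp add: F_def)
  qed
  then show ?thesis by blast
qed

subsection \<open>The gap in the target\<close>

text \<open>Monotonicity of the gradient is applied to \<open>p\<close> and its mirror image; by
  symmetry both differences are multiples of (1, -1).\<close>

lemma cross_nonneg:
  assumes p: "p \<in> W" and "fst p > snd p"
  shows "0 \<le> cross p"
proof -
  have "0 \<le> 2 * ((fst p - snd p) * (px \<phi> p - py \<phi> p))"
    using grad_monotone[OF p swap_W[OF p]] unfolding grad_swap[OF p]
    by (simp add: grad_def inner_prod_def algebra_simps)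
  then show ?thesis using assms by (simp add: cross_def zero_le_mult_iff)
qed

lemma cross_nonpos:
  assumes p: "p \<in> W" and "fst p < snd p"
  shows "cross p \<le> 0"
  using cross_nonneg[OF swap_W[OF p]] grad_swap[OF p] assms by (simp add: cross_def grad_def)

text \<open>\<open>Theta_gap\<close> leaves two alternatives, and the sign of \<open>cross p\<close>
  below the diagonal rules out the negative one.\<close>

lemma cross_gap:
  assumes p: "p \<in> W" and "fst p > snd p" "V p > 0"
  shows "2 * V p \<le> cross p"
  using Theta_gap[OF grad_in_Theta[OF p]] cross_nonneg[OF assms(1,2)] V_grad[OF p] assms(3)
  by (auto simp: grad_def cross_def)

lemma emeasure_strip_Omega:
  assumes "0 < e"
  shows "emeasure lborel {p. \<bar>fst p\<bar> \<le> 1/2 \<and> 0 \<le> fst p - snd p \<and> fst p - snd p \<le> e} \<le> ennreal e"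
proof -
  let ?A = "{p :: real \<times> real. \<bar>fst p\<bar> \<le> 1/2 \<and> 0 \<le> fst p - snd p \<and> fst p - snd p \<le> e}"
  have "closed ?A" by (intro closed_Collect_conj closed_Collect_le continuous_intros)
  then have A: "?A \<in> sets (lborel \<Otimes>\<^sub>M lborel)" unfolding lborel_prod by auto
  have "emeasure lborel ?A = (\<integral>\<^sup>+x. emeasure lborel (Pair x -` ?A) \<partial>lborel)"
    unfolding lborel_prod[symmetric] by (rule lborel.emeasure_pair_measure_alt[OF A])
  also have "\<dots> = (\<integral>\<^sup>+x. ennreal e * indicator {-1/2..1/2::real} x \<partial>lborel)"
  proof (rule nn_integral_cong)
    fix x :: real
    have "Pair x -` ?A = (if x \<in> {-1/2..1/2} then {x - e..x} else {})" by (auto simp: abs_le_iff)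
    then show "emeasure lborel (Pair x -` ?A) = ennreal e * indicator {-1/2..1/2} x"
      using assms by simp
  qed
  also have "\<dots> = ennreal e" by (subst nn_integral_cmult) auto
  finally show ?thesis by simp
qed

text \<open>The part of \<open>Theta\<close> between the edge \<open>d = 2 v\<close> and the image of the line \<open>u = e\<close> can only
  be reached from the strip \<open>0 \<le> u \<le> e\<close>, by monotonicity of the gradient; its area is therefore
  \<open>O(e)\<close>.\<close>

lemma gap_area:
  fixes \<Psi> :: "real \<Rightarrow> real"
  assumes v: "0 < v1" "v1 \<le> v2" and e: "0 < e"
    and line: "\<And>v. v1 \<le> v \<Longrightarrow> v \<le> v2 \<Longrightarrow> Complex v e \<in> S"
    and \<Psi>: "\<And>v. v1 \<le> v \<Longrightarrow> v \<le> v2 \<Longrightarrow> (\<Psi> has_real_derivative (Im (F (Complex v e)) - 2 * v)) (at v)"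
  shows "\<Psi> v1 \<le> \<Psi> v2" and "\<Psi> v2 - \<Psi> v1 \<le> e"
proof -
  have W: "X (Complex v e) \<in> W" if "v1 \<le> v" "v \<le> v2" for v
    using line[OF that] e by (intro X_in_W) (auto simp: complex_nonneg_Reals_iff)
  have XV: "V (X (Complex v e)) = v" "fst (X (Complex v e)) - snd (X (Complex v e)) = e"
    if "v1 \<le> v" "v \<le> v2" for v
    using arg_cong[OF T_X, of "Complex v e" Re] arg_cong[OF T_X, of "Complex v e" Im] line[OF that] S_subset
    by (auto simp: Re_T Im_T)
  have ge: "2 * v \<le> Im (F (Complex v e))" if "v1 \<le> v" "v \<le> v2" for v
    using cross_gap[OF W[OF that]] XV[OF that] v e that by (simp add: F_def)
  show "\<Psi> v1 \<le> \<Psi> v2"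
    by (rule DERIV_nonneg_imp_nondecreasing[OF v(2)]) (use \<Psi> ge in \<open>fastforce\<close>)
  \<comment> \<open>Height of the image of the line u = e above the edge d = 2 v, extended by 0
    outside the interval.\<close>
  define f where "f v = (if v \<in> {v1..v2} then Im (F (Complex v e)) - 2 * v else 0)" for v
  have cF: "continuous_on {v1..v2} (\<lambda>v. Im (F (Complex v e)) - 2 * v)"
  proof -
    have "continuous_on {v1..v2} (\<lambda>v. F (Complex v e))"
      by (rule continuous_on_compose2[OF holomorphic_on_imp_continuous_on[OF F_holomorphic]])
         (use line e in \<open>auto simp: Complex_eq complex_nonneg_Reals_iff intro!: continuous_intros\<close>)
    then show ?thesis by (intro continuous_intros)
  qed
  have fb [measurable]: "f \<in> borel_measurable borel"
    unfolding f_def by (rule borel_measurable_continuous_on_if) (auto intro: cF)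
  have FTC: "(\<integral>\<^sup>+x. ennreal (f x) * indicator {v1..v2} x \<partial>lborel) = \<Psi> v2 - \<Psi> v1"
    by (rule nn_integral_FTC_Icc[OF fb _ _ v(2)])
       (use \<Psi> ge in \<open>auto simp: f_def intro: has_field_derivative_at_within\<close>)
  \<comment> \<open>The region between the edge and that image, written in the coordinates v and d.
    The upper bound is strict, so that points of its preimage have \<open>cross\<close> strictly
    below the value on the line u = e.\<close>
  define B where "B = {q :: real \<times> real. fst q + snd q \<in> {v1..v2} \<and> 0 \<le> (fst q - snd q) / 2 - 2 * (fst q + snd q) \<and>
      (fst q - snd q) / 2 - 2 * (fst q + snd q) < f (fst q + snd q)}"
  have "{q \<in> space (borel \<Otimes>\<^sub>M borel). fst q + snd q \<in> {v1..v2} \<and> 0 \<le> (fst q - snd q) / 2 - 2 * (fst q + snd q) \<and>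
      (fst q - snd q) / 2 - 2 * (fst q + snd q) < f (fst q + snd q)} \<in> sets (borel \<Otimes>\<^sub>M borel)"
    by measurable
  then have Bm: "B \<in> sets borel"
    unfolding B_def borel_prod space_borel by (simp only: UNIV_I simp_thms)
  have "emeasure lborel B = (\<integral>\<^sup>+x. indicator B x \<partial>lborel)" using Bm by simp
  also have "\<dots> = (\<integral>\<^sup>+v. \<integral>\<^sup>+d. indicator B (v / 2 + d, v / 2 - d) \<partial>lborel \<partial>lborel)"
    by (rule nn_integral_lborel_rotated) (use Bm in simp)
  also have "\<dots> = (\<integral>\<^sup>+v. ennreal (f v) * indicator {v1..v2} v \<partial>lborel)"
  proof (rule nn_integral_cong)
    fix v :: real
    have "(\<integral>\<^sup>+d. indicator B (v / 2 + d, v / 2 - d) \<partial>lborel) = 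
       (\<integral>\<^sup>+d. indicator {v1..v2} v * indicator {2 * v..<2 * v + f v} d \<partial>lborel)"
      by (rule nn_integral_cong) (auto simp: B_def indicator_def)
    also have "\<dots> = indicator {v1..v2} v * emeasure lborel {2 * v..<2 * v + f v}"
      by (subst nn_integral_cmult) auto
    also have "\<dots> = ennreal (f v) * indicator {v1..v2} v"
      using ge by (auto simp: f_def indicator_def)
    finally show "(\<integral>\<^sup>+d. indicator B (v / 2 + d, v / 2 - d) \<partial>lborel) = ennreal (f v) * indicator {v1..v2} v" .
  qed
  finally have area: "emeasure lborel B = ennreal (\<Psi> v2 - \<Psi> v1)" using FTC by simp
  have "B \<subseteq> Theta"
  proof
    fix q assume q: "q \<in> B"
    define v where "v = fst q + snd q"
    define d where "d = (fst q - snd q) / 2"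
    have vd: "v1 \<le> v" "v \<le> v2" "2 * v \<le> d" "d < Im (F (Complex v e))"
      using q by (auto simp: B_def f_def v_def d_def)
    have "(v / 2 + d, v / 2 - d) \<in> Theta"
    proof (rule Theta_fill[OF grad_in_Theta[OF W[OF vd(1,2)]]])
      show "v = fst (grad (X (Complex v e))) + snd (grad (X (Complex v e)))"
        using XV(1)[OF vd(1,2)] V_grad[OF W[OF vd(1,2)]] by simp
      show "d \<le> (fst (grad (X (Complex v e))) - snd (grad (X (Complex v e)))) / 2"
        using vd(4) by (simp add: grad_def F_def cross_def)
    qed (use vd v in auto)
    moreover have "q = (v / 2 + d, v / 2 - d)" by (simp add: v_def d_def prod_eq_iff field_simps)
    ultimately show "q \<in> Theta" by simp
  qed
  \<comment> \<open>Since \<open>B\<close> lies in \<open>Theta\<close>, its area is that of its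
    preimage under the gradient, which is confined to the strip.\<close>
  then have "emeasure lborel B = emeasure lborel {p \<in> W. grad p \<in> B}"
    using emeasure_grad_vimage[OF Bm] by (simp add: Int_absorb1)
  also have "\<dots> \<le> emeasure lborel {p. \<bar>fst p\<bar> \<le> 1/2 \<and> 0 \<le> fst p - snd p \<and> fst p - snd p \<le> e}"
  proof (rule emeasure_mono)
    show "{p \<in> W. grad p \<in> B} \<subseteq> {p. \<bar>fst p\<bar> \<le> 1/2 \<and> 0 \<le> fst p - snd p \<and> fst p - snd p \<le> e}"
    proof safe
      fix a b assume p: "(a, b) \<in> W" and B: "grad (a, b) \<in> B"
      define p where "p = (a, b)"
      have pW: "p \<in> W" using p by (simp add: p_def)
      note V = V_grad[OF pW]
      have V2: "v1 \<le> V p" "V p \<le> v2" "2 * V p \<le> cross p" "cross p < Im (F (Complex (V p) e))"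
        using B unfolding p_def[symmetric] B_def by (auto simp: f_def V grad_def cross_def)
      \<comment> \<open>\<open>q\<close> lies on the line u = e and has the same v as
        \<open>p\<close>. In the monotonicity inequality the v-term vanishes, leaving a product of
        \<open>cross q - cross p\<close>, which is positive, and
        \<open>e - (fst p - snd p)\<close>.\<close>
      define q where "q = X (Complex (V p) e)"
      have q: "q \<in> W" "V q = V p" "fst q - snd q = e" "cross p < cross q"
        using W[OF V2(1,2)] XV[OF V2(1,2)] V2(4) by (auto simp: q_def F_def)
      have "0 \<le> (grad q - grad p) \<bullet> (q - p)" by (rule grad_monotone[OF q(1) pW])
      also have "\<dots> = (V q - V p) * ((fst q + snd q) - (fst p + snd p)) / 2
          + (cross q - cross p) * ((fst q - snd q) - (fst p - snd p))"
        using V_grad[OF q(1)] V by (simp add: grad_def inner_prod_def cross_def field_simps)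
      finally have "0 \<le> (cross q - cross p) * (e - (fst p - snd p))" using q by simp
      then show "fst (a, b) - snd (a, b) \<le> e" using q(4) by (simp add: zero_le_mult_iff p_def)
      \<comment> \<open>On the other side of the diagonal \<open>cross\<close> would be nonpositive,
        whereas \<open>cross p\<close> is at least 2 v > 0.\<close>
      show "0 \<le> fst (a, b) - snd (a, b)" 
        using cross_nonpos[OF pW] V2 v by (simp add: p_def) (smt (verit))
      show "\<bar>fst (a, b)\<bar> \<le> 1/2" using Omega_bounds[OF W_Omega[OF p]] by simp
    qed
    have "closed {p :: real \<times> real. \<bar>fst p\<bar> \<le> 1/2 \<and> 0 \<le> fst p - snd p \<and> fst p - snd p \<le> e}"
      by (intro closed_Collect_conj closed_Collect_le continuous_intros)
    then show "{p :: real \<times> real. \<bar>fst p\<bar> \<le> 1/2 \<and> 0 \<le> fst p - snd p \<and> fst p - snd p \<le> e} \<in> sets lborel" by auto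
  qed
  also have "\<dots> \<le> ennreal e" by (rule emeasure_strip_Omega[OF e])
  finally show "\<Psi> v2 - \<Psi> v1 \<le> e" using area e by (simp add: ennreal_le_iff)
qed

end

section \<open>Estimates and gluing for functions on a slit domain\<close>

lemma Re_of_real_mult: "Re (of_real a * z) = a * Re z"
  by simp

text \<open>The modulus contributes t (- ln t) <= 1 for 0 < t <= 1, from ln x <= x - 1 at x = 1 / t,
  and the argument at most pi. The bound serves to remove the singularity at the origin.\<close>

lemma norm_mult_Ln_minus_le:
  assumes "w \<noteq> 0" "norm w \<le> 1"
  shows "norm (w * Ln (- w)) \<le> 1 + pi"
proof -
  have n: "0 < norm w" using assms by simp
  have neg: "ln (norm w) \<le> 0" using assms by simp
  have "- ln (norm w) \<le> 1 / norm w - 1"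
    using ln_le_minus_one[of "1 / norm w"] n by (simp add: ln_div)
  then have "norm w * (- ln (norm w)) \<le> norm w * (1 / norm w - 1)"
    by (rule mult_left_mono) simp
  moreover have "norm w * (1 / norm w - 1) \<le> 1" using n by (simp add: right_diff_distrib)
  ultimately have "norm w * (- ln (norm w)) \<le> 1" by linarith
  moreover have "\<bar>Im (Ln (- w))\<bar> \<le> pi"
    using mpi_less_Im_Ln[of "- w"] Im_Ln_le_pi[of "- w"] assms by (auto simp: abs_le_iff)
  then have "norm w * \<bar>Im (Ln (- w))\<bar> \<le> 1 * pi" using assms by (intro mult_mono) auto
  ultimately have "norm w * (\<bar>Re (Ln (- w))\<bar> + \<bar>Im (Ln (- w))\<bar>) \<le> 1 + pi"
    using assms neg by (simp add: distrib_left right_diff_distrib)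
  moreover have "norm (w * Ln (- w)) \<le> norm w * (\<bar>Re (Ln (- w))\<bar> + \<bar>Im (Ln (- w))\<bar>)"
    unfolding norm_mult by (rule mult_left_mono[OF cmod_le]) simp
  ultimately show ?thesis by linarith
qed

text \<open>Local continuations agree on overlaps because the slit has empty interior, so they glue
  to a function off 0. The bound persists across the slit by continuity and makes 0 a removable
  singularity.\<close>

lemma holomorphic_extends_across_slit:
  assumes S: "open S" "0 \<in> S" and M: "M holomorphic_on (S - \<real>\<^sub>\<ge>\<^sub>0)"
    and loc: "\<And>v. 0 < v \<Longrightarrow> of_real v \<in> S \<Longrightarrow> \<exists>r>0. \<exists>N. ball (of_real v) r \<subseteq> S \<and>
      N holomorphic_on ball (of_real v) r \<and> (\<forall>w\<in>ball (of_real v) r - \<real>\<^sub>\<ge>\<^sub>0. N w = M w)"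
    and bd: "\<And>w. w \<in> S - \<real>\<^sub>\<ge>\<^sub>0 \<Longrightarrow> norm w \<le> 1 \<Longrightarrow> norm (M w) \<le> K"
  obtains G where "G holomorphic_on S" "\<And>w. w \<in> S - \<real>\<^sub>\<ge>\<^sub>0 \<Longrightarrow> G w = M w"
proof -
  define P where "P w r N \<longleftrightarrow> r > 0 \<and> ball w r \<subseteq> S \<and> N holomorphic_on ball w r \<and>
    (\<forall>z\<in>ball w r - \<real>\<^sub>\<ge>\<^sub>0. N z = M z)" for w r N
  have "\<exists>N r. P w r N" if w: "w \<in> S - {0}" for w
  proof (cases "w \<in> \<real>\<^sub>\<ge>\<^sub>0")
    case True
    then obtain v where "w = of_real v" "0 \<le> v" by (auto simp: nonneg_Reals_def)
    then show ?thesis using loc[of v] w by (auto simp: P_def)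
  next
    case False
    have "open (S - \<real>\<^sub>\<ge>\<^sub>0)" using S closed_nonneg_Reals_complex by auto
    then obtain r where "r > 0" "ball w r \<subseteq> S - \<real>\<^sub>\<ge>\<^sub>0" using w False open_contains_ball by blast
    then have "P w r M" using holomorphic_on_subset[OF M] by (auto simp: P_def)
    then show ?thesis by blast
  qed
  then obtain N r where N: "\<And>w. w \<in> S - {0} \<Longrightarrow> P w (r w) (N w)" by metis
  define G where "G w = N w w" for w
  have GN: "G z = N w z" if w: "w \<in> S - {0}" and z: "z \<in> ball w (r w)" "z \<noteq> 0" for w z
  proof -
    have zS: "z \<in> S - {0}" using N[OF w] z by (auto simp: P_def)
    let ?U = "ball w (r w) \<inter> ball z (r z)"
    have "N z z = N w z"
    proof (rule continuous_eq_across_slit[of ?U "N z" "N w"])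
      show "continuous_on ?U (N z)" "continuous_on ?U (N w)"
        using N[OF w] N[OF zS] unfolding P_def
        by (meson Int_lower1 Int_lower2 continuous_on_subset holomorphic_on_imp_continuous_on)+
      show "N z x = N w x" if "x \<in> ?U - \<real>\<^sub>\<ge>\<^sub>0" for x
        using N[OF w] N[OF zS] that unfolding P_def by (metis DiffD1 DiffD2 DiffI IntD1 IntD2)
      show "z \<in> ?U" using z N[OF zS] by (simp add: P_def)
    qed auto
    then show ?thesis by (simp add: G_def)
  qed
  have GM: "G w = M w" if "w \<in> S - \<real>\<^sub>\<ge>\<^sub>0" for w
  proof -
    have "w \<in> S - {0}" using that by auto
    then show ?thesis using N[of w] that by (auto simp: G_def P_def)
  qed
  have G: "G holomorphic_on (S - {0})"
  proof -
    have "G field_differentiable (at w)" if w: "w \<in> S - {0}" for w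
    proof -
      let ?B = "ball w (r w) - {0}"
      have "N w holomorphic_on ?B" using N[OF w] unfolding P_def by (meson Diff_subset holomorphic_on_subset)
      then have "G holomorphic_on ?B" by (rule holomorphic_transform) (use GN[OF w] in auto)
      moreover have "w \<in> ?B" "open ?B" using N[OF w] w by (auto simp: P_def)
      ultimately show ?thesis by (simp add: holomorphic_on_imp_differentiable_at)
    qed
    then show ?thesis by (auto simp: holomorphic_on_def intro: field_differentiable_at_within)
  qed
  have bdG: "norm (G w) \<le> K" if w: "w \<in> S - {0}" "norm w < 1" for w
  proof (rule ccontr)
    assume "\<not> norm (G w) \<le> K"
    let ?U = "{z \<in> (S - {0}) \<inter> ball 0 1. norm (G z) \<in> {K<..}}"
    have o: "open ((S - {0}) \<inter> ball 0 1)" using S by auto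
    have "continuous_on ((S - {0}) \<inter> ball 0 1) (\<lambda>z. norm (G z))"
      by (intro continuous_on_norm continuous_on_subset[OF holomorphic_on_imp_continuous_on[OF G]]) auto
    then have "open ?U"
      using continuous_open_preimage[OF _ o, of "\<lambda>z. norm (G z)" "{K<..}"]
      by (simp add: vimage_def Int_def)
    moreover have "w \<in> ?U" using w \<open>\<not> norm (G w) \<le> K\<close> by auto
    ultimately obtain z where "z \<in> ?U" "z \<notin> \<real>\<^sub>\<ge>\<^sub>0" by (rule open_contains_nonreal)
    then show False using bd[of z] GM[of z] by auto
  qed
  have "\<forall>\<^sub>F w in at 0. norm (G w) \<le> K"
  proof -
    have "open (S \<inter> ball 0 1)" "0 \<in> S \<inter> ball 0 1" using S by auto
    then have "\<forall>\<^sub>F w in at 0. w \<in> S \<inter> ball 0 1 - {0}"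
      by (rule eventually_at_in_open)
    then show ?thesis by eventually_elim (use bdG in auto)
  qed
  then have "\<exists>g. g holomorphic_on S \<and> (\<forall>z \<in> S - {0}. g z = G z)"
    using holomorphic_on_extend_bounded[OF G] S by (auto simp: interior_open)
  then obtain g where g: "g holomorphic_on S" "\<And>z. z \<in> S - {0} \<Longrightarrow> g z = G z" by blast
  show ?thesis
  proof (rule that[OF g(1)])
    fix w assume w: "w \<in> S - \<real>\<^sub>\<ge>\<^sub>0"
    then have "w \<in> S - {0}" by auto
    then show "g w = M w" using g(2) GM[OF w] by simp
  qed
qed

context brenier
begin

subsection \<open>Crossing the slit\<close>

text \<open>The gap estimate controls integrals of d - 2 v along horizontal lines, not pointwise
  values. Hence reflection is applied to a primitive of F - 2 i w, which is Lipschitz and so has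
  boundary values; the continuation is obtained by differentiating.\<close>

lemma crossing:
  assumes v0: "0 < v0" "of_real v0 \<in> S"
  shows "\<exists>r>0. \<exists>N. ball (of_real v0) r \<subseteq> S \<and> N holomorphic_on ball (of_real v0) r \<and>
    (\<forall>w\<in>ball (of_real v0) r - \<real>\<^sub>\<ge>\<^sub>0. N w = F w + 2 / pi * (w * Ln (- w)))"
proof -
  obtain r0 where r0: "r0 > 0" "ball (of_real v0) r0 \<subseteq> S" using open_S v0 open_contains_ball by blast
  \<comment> \<open>The bound by \<open>v0\<close> keeps the disc in the right half plane, where v >
    0 as the gap estimate requires and \<open>Ln w\<close> is holomorphic.\<close>
  define r where "r = min r0 v0"
  have r: "r > 0" "r \<le> v0" using r0 v0 by (auto simp: r_def)
  define B where "B = ball (complex_of_real v0) r"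
  have BS: "B \<subseteq> S" using r0 by (auto simp: B_def r_def)
  have oB: "open B" by (simp add: B_def)
  have Bpos: "Re w > 0" if "w \<in> B" for w
  proof -
    have "norm (of_real v0 - w) < r" using that by (simp add: B_def dist_norm)
    then show ?thesis using complex_Re_le_cmod[of "of_real v0 - w"] r by simp
  qed
  have v0B: "of_real v0 \<in> B" using r by (simp add: B_def)
  define H where "H = B \<inter> {w. 0 < Im w}"
  have oH: "open H" unfolding H_def by (intro open_Int oB open_halfspace_Im_gt)
  have cH: "convex H" unfolding H_def B_def by (intro convex_Int convex_ball convex_halfspace_Im_gt)
  have HS: "H \<subseteq> S - \<real>\<^sub>\<ge>\<^sub>0" using BS by (auto simp: H_def complex_nonneg_Reals_iff)
  define N where "N w = F w - 2 * \<i> * w" for w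
  have N: "N holomorphic_on H"
    unfolding N_def by (intro holomorphic_intros holomorphic_on_subset[OF F_holomorphic HS])
  obtain K0 where K0: "\<And>w. w \<in> S - \<real>\<^sub>\<ge>\<^sub>0 \<Longrightarrow> norm (F w) \<le> K0" using bounded_F by blast
  \<comment> \<open>A bound for \<open>N\<close> on \<open>H\<close>, hence a Lipschitz constant for
    its primitive on this convex set; \<open>\<bar>K0\<bar>\<close> makes it visibly
    nonnegative.\<close>
  define K where "K = \<bar>K0\<bar> + 2 * (v0 + r)"
  have K: "norm (N w) \<le> K" if "w \<in> H" for w
  proof -
    have "norm w \<le> v0 + r"
      using that v0 norm_triangle_ineq2[of w "of_real v0"] by (auto simp: H_def B_def dist_norm norm_minus_commute)
    then have "norm (2 * \<i> * w) \<le> 2 * (v0 + r)" by (simp add: norm_mult)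
    moreover have "norm (F w) \<le> K0" using K0 HS that by blast
    ultimately show ?thesis using norm_triangle_ineq4[of "F w" "2 * \<i> * w"] by (simp add: N_def K_def)
  qed
  obtain \<Phi> where "\<And>w. w \<in> H \<Longrightarrow> (\<Phi> has_field_derivative N w) (at w within H)"
    using holomorphic_convex_primitive'[OF cH oH N] by blast
  then have \<Phi>: "(\<Phi> has_field_derivative N w) (at w)" if "w \<in> H" for w
    using that at_within_open[OF that oH] by metis
  have "K-lipschitz_on H \<Phi>"
  proof (rule lipschitz_onI)
    show "dist (\<Phi> x) (\<Phi> y) \<le> K * dist x y" if "x \<in> H" "y \<in> H" for x y
      unfolding dist_norm
      by (rule field_differentiable_bound[OF cH has_field_derivative_at_within[OF \<Phi>] K that])
    show "0 \<le> K" using v0 r by (simp add: K_def)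
  qed
  then obtain \<Psi> where \<Psi>: "K-lipschitz_on (closure H) \<Psi>" "\<And>w. w \<in> H \<Longrightarrow> \<Psi> w = \<Phi> w"
    using lipschitz_extend_closure by blast
  have c\<Psi>: "continuous_on (closure H) \<Psi>" by (rule lipschitz_on_continuous_on[OF \<Psi>(1)])
  define e where "e n = inverse (real (Suc n))" for n
  have e0: "e \<longlonglongrightarrow> 0" unfolding e_def by (rule LIMSEQ_inverse_real_of_nat)
  have epos: "e n > 0" for n by (simp add: e_def)
  have lim: "(\<lambda>n. Complex x (e n)) \<longlonglongrightarrow> of_real x" for x
    using tendsto_Complex[OF tendsto_const e0, of x] by (simp add: Complex_eq)
  have ev: "\<forall>\<^sub>F n in sequentially. Complex x (e n) \<in> H" if "of_real x \<in> B" for x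
    using topological_tendstoD[OF lim oB that] by eventually_elim (simp add: H_def epos)
  have clos: "B \<inter> {w. 0 \<le> Im w} \<subseteq> closure H"
  proof
    fix w assume w: "w \<in> B \<inter> {w. 0 \<le> Im w}"
    show "w \<in> closure H"
    proof (cases "Im w = 0")
      case True
      then have "w = of_real (Re w)" by (simp add: complex_eq_iff)
      moreover have "of_real (Re w) \<in> closure H"
      proof (rule Lim_in_closed_set[OF closed_closure _ _ lim])
        show "\<forall>\<^sub>F n in sequentially. Complex (Re w) (e n) \<in> closure H"
          using ev[of "Re w"] w \<open>w = of_real (Re w)\<close> closure_subset[of H] by (auto elim: eventually_mono)
      qed simp
      ultimately show ?thesis by simp
    next
      case False
      then show ?thesis using w closure_subset[of H] by (auto simp: H_def)
    qed
  qed
  have lim\<Psi>: "(\<lambda>n. Im (\<Phi> (Complex x (e n)))) \<longlonglongrightarrow> Im (\<Psi> (of_real x))" if x: "of_real x \<in> B" for x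
  proof -
    have "\<forall>\<^sub>F n in sequentially. Complex x (e n) \<in> closure H"
      using ev[OF x] by eventually_elim (use closure_subset in blast)
    then have "(\<lambda>n. \<Psi> (Complex x (e n))) \<longlonglongrightarrow> \<Psi> (of_real x)"
      by (rule continuous_on_tendsto_compose[OF c\<Psi> lim, rotated]) (use clos x in auto)
    then have "(\<lambda>n. Im (\<Psi> (Complex x (e n)))) \<longlonglongrightarrow> Im (\<Psi> (of_real x))" by (rule tendsto_Im)
    moreover have "\<forall>\<^sub>F n in sequentially. Im (\<Psi> (Complex x (e n))) = Im (\<Phi> (Complex x (e n)))"
      using ev[OF x] by eventually_elim (simp add: \<Psi>(2))
    ultimately show ?thesis by (rule Lim_transform_eventually)
  qed
  \<comment> \<open>On the line of height \<open>e n\<close> the derivative of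
    \<open>Im \<Phi>\<close> is d - 2 v, so \<open>gap_area\<close> puts its increment between 0 and
    \<open>e n\<close>. In the limit \<open>Im \<Psi>\<close> is constant on the real
    diameter.\<close>
  have const: "Im (\<Psi> (of_real x)) = Im (\<Psi> (of_real y))" if x: "of_real x \<in> B" and y: "of_real y \<in> B" and xy: "x \<le> y" for x y
  proof -
    have "\<forall>\<^sub>F n in sequentially. norm (Im (\<Phi> (Complex y (e n))) - Im (\<Phi> (Complex x (e n)))) \<le> e n"
      using ev[OF x] ev[OF y]
    proof eventually_elim
      case (elim n)
      have line: "Complex v (e n) \<in> H" if v: "x \<le> v" "v \<le> y" for v
      proof -
        have "Complex v (e n) \<in> closed_segment (Complex x (e n)) (Complex y (e n))"
          using v by (simp add: closed_segment_same_Im closed_segment_eq_real_ivl)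
        then show ?thesis using closed_segment_subset[OF elim(1) elim(2) cH] by blast
      qed
      have "((\<lambda>v. Im (\<Phi> (Complex v (e n)))) has_real_derivative Im (F (Complex v (e n))) - 2 * v) (at v)"
        if "x \<le> v" "v \<le> y" for v
      proof -
        have cv: "((\<lambda>v. Complex v (e n)) has_vector_derivative 1) (at v)"
          unfolding Complex_eq by (auto intro!: derivative_eq_intros)
        have "((\<lambda>v. \<Phi> (Complex v (e n))) has_vector_derivative 1 * N (Complex v (e n))) (at v)"
          using field_vector_diff_chain_at[where f = "\<lambda>v. Complex v (e n)" and g = \<Phi>, OF cv \<Phi>[OF line[OF that]]]
          by (simp add: o_def)
        then have "((\<lambda>v. Im (\<Phi> (Complex v (e n)))) has_vector_derivative Im (N (Complex v (e n)))) (at v)"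
          using bounded_linear.has_vector_derivative[OF bounded_linear_Im] by fastforce
        then show ?thesis by (simp add: N_def has_real_derivative_iff_has_vector_derivative)
      qed
      note area = gap_area[OF _ xy epos _ this]
      have "0 < x" using Bpos[OF x] by simp
      then show ?case using area line HS by force
    qed
    then have "(\<lambda>n. Im (\<Phi> (Complex y (e n))) - Im (\<Phi> (Complex x (e n)))) \<longlonglongrightarrow> 0"
      by (rule Lim_null_comparison[OF _ e0])
    moreover have "(\<lambda>n. Im (\<Phi> (Complex y (e n))) - Im (\<Phi> (Complex x (e n)))) \<longlonglongrightarrow> Im (\<Psi> (of_real y)) - Im (\<Psi> (of_real x))"
      by (intro tendsto_diff lim\<Psi> x y)
    ultimately show ?thesis using LIMSEQ_unique by fastforce
  qed
  define c where "c = Im (\<Psi> (of_real v0))"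
  have real: "Im (\<Psi> (of_real x)) = c" if "of_real x \<in> B" for x
    unfolding c_def using const[OF that v0B] const[OF v0B that] linear[of x v0] by metis
  \<comment> \<open>Subtracting the constant imaginary boundary value makes the primitive real on
    the slit, as Schwarz reflection demands.\<close>
  define \<Psi>' where "\<Psi>' w = \<Psi> w - \<i> * of_real c" for w
  define E where "E w = (if 0 \<le> Im w then \<Psi>' w else cnj (\<Psi>' (cnj w)))" for w
  have cnjB: "cnj w \<in> B" if "w \<in> B" for w
    using that complex_mod_cnj[of "of_real v0 - w"] by (simp add: B_def dist_norm del: complex_mod_cnj)
  have D\<Psi>': "(\<Psi>' has_field_derivative N w) (at w)" if "w \<in> H" for w
  proof (rule has_field_derivative_transform_within_open[OF _ oH that])
    show "((\<lambda>w. \<Phi> w - \<i> * of_real c) has_field_derivative N w) (at w)"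
      using \<Phi>[OF that] by (auto intro!: derivative_eq_intros)
  qed (simp add: \<Psi>'_def \<Psi>(2))
  have E: "E holomorphic_on B"
    unfolding E_def
  proof (rule Schwarz_reflection[OF oB])
    show "cnj ` B \<subseteq> B" using cnjB by blast
    show "\<Psi>' holomorphic_on B \<inter> {z. 0 < Im z}"
      unfolding H_def[symmetric] holomorphic_on_open[OF oH] using D\<Psi>' by blast
    show "continuous_on (B \<inter> {z. 0 \<le> Im z}) \<Psi>'"
      unfolding \<Psi>'_def by (intro continuous_intros continuous_on_subset[OF c\<Psi> clos])
    show "\<Psi>' z \<in> \<real>" if "z \<in> B" "z \<in> \<real>" for z
      using that real[of "Re z"] by (simp add: complex_is_Real_iff \<Psi>'_def of_real_Re)
  qed
  have upper: "deriv E w = F w - 2 * \<i> * w" if w: "w \<in> B" "0 < Im w" for w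
  proof -
    have "w \<in> H" using w by (simp add: H_def)
    then have "(E has_field_derivative N w) (at w)"
      by (intro has_field_derivative_transform_within_open[OF D\<Psi>' oH]) (auto simp: E_def H_def)
    then show ?thesis using DERIV_imp_deriv N_def by metis
  qed
  have lower: "deriv E w = F w + 2 * \<i> * w" if w: "w \<in> B" "Im w < 0" for w
  proof -
    have cw: "cnj w \<in> H" using w cnjB by (simp add: H_def)
    have o: "open {w. Im w < 0}" by (rule open_halfspace_Im_lt)
    have "((\<lambda>z. cnj (\<Psi>' (cnj z))) has_field_derivative cnj (N (cnj w))) (at w)"
      using has_field_derivative_cnj_cnj[of \<Psi>' "N (cnj w)" w] D\<Psi>'[OF cw] by (simp add: o_def)
    then have "(E has_field_derivative cnj (N (cnj w))) (at w)"
      by (rule has_field_derivative_transform_within_open[OF _ o]) (use w in \<open>auto simp: E_def\<close>)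
    \<comment> \<open>The symmetry of \<open>F\<close> makes the reflection reproduce
      \<open>F\<close> itself below the slit, with the opposite correction term.\<close>
    moreover have "F (cnj w) = cnj (F w)"
      using w BS by (intro F_cnj) (auto simp: complex_nonneg_Reals_iff)
    ultimately show ?thesis using DERIV_imp_deriv by (fastforce simp: N_def)
  qed
  \<comment> \<open>\<open>Ln (- w)\<close> is \<open>Ln w\<close> minus or plus
    \<open>\<i> * pi\<close> above or below the slit, so the factor \<open>2 / pi\<close> makes the
    logarithmic term absorb the corrections - 2 i w and + 2 i w exactly.\<close>
  define N' where "N' w = deriv E w + 2 / pi * (w * Ln w)" for w
  have "N' holomorphic_on B"
    unfolding N'_def
    by (intro holomorphic_intros holomorphic_deriv[OF E oB]) (auto dest!: Bpos simp: complex_nonpos_Reals_iff)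
  moreover have "N' w = F w + 2 / pi * (w * Ln (- w))" if w: "w \<in> B - \<real>\<^sub>\<ge>\<^sub>0" for w
  proof (cases "0 < Im w")
    case True
    then have Ln: "Ln (- w) = Ln w - \<i> * pi" by (subst Ln_minus) auto
    have dE: "deriv E w = F w - 2 * \<i> * w" using upper w True by blast
    show ?thesis unfolding N'_def Ln dE by (simp add: field_simps)
  next
    case False
    then have "Im w < 0" using w Bpos[of w] by (auto simp: complex_nonneg_Reals_iff)
    then have Ln: "Ln (- w) = Ln w + \<i> * pi" by (subst Ln_minus) auto
    have dE: "deriv E w = F w + 2 * \<i> * w" using lower w \<open>Im w < 0\<close> by blast
    show ?thesis unfolding N'_def Ln dE by (simp add: field_simps)
  qed
  ultimately show ?thesis using r BS unfolding B_def by blast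
qed

text \<open>Differentiating F + (2 / pi) w Ln (- w) and taking real parts turns Re F' = 1 / \<rho>
  into the formula; the additive constant 2 / pi comes from the product rule. The \<open>G\<close>
  supplied is the derivative of the extended function.\<close>

lemma holomorphic_representation:
  obtains G where "G holomorphic_on S"
    "\<And>w. w \<in> S - {0} \<Longrightarrow> 1 / R (X w) = - (2 / pi) * ln (norm w) + (Re (G w) - 2 / pi)"
proof -
  let ?M = "\<lambda>w. F w + 2 / pi * (w * Ln (- w))"
  obtain K where K: "\<And>w. w \<in> S - \<real>\<^sub>\<ge>\<^sub>0 \<Longrightarrow> norm (F w) \<le> K" using bounded_F by blast
  have M: "?M holomorphic_on (S - \<real>\<^sub>\<ge>\<^sub>0)"
    by (intro holomorphic_intros F_holomorphic) (simp add: uminus_nonpos_Reals_iff)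
  have bd: "norm (?M w) \<le> K + 2 / pi * (1 + pi)" if "w \<in> S - \<real>\<^sub>\<ge>\<^sub>0" "norm w \<le> 1" for w
  proof -
    have "w \<noteq> 0" using that by auto
    then have "norm (2 / pi * (w * Ln (- w))) \<le> 2 / pi * (1 + pi)"
      using norm_mult_Ln_minus_le[of w] that by (simp add: norm_mult norm_divide divide_right_mono)
    then show ?thesis using norm_triangle_ineq[of "F w" "2 / pi * (w * Ln (- w))"] K[OF that(1)] by linarith
  qed
  obtain G where G: "G holomorphic_on S" "\<And>w. w \<in> S - \<real>\<^sub>\<ge>\<^sub>0 \<Longrightarrow> G w = ?M w"
    using holomorphic_extends_across_slit[OF open_S zero_in_S M crossing bd] by blast
  have oS: "open (S - \<real>\<^sub>\<ge>\<^sub>0)" using open_S closed_nonneg_Reals_complex by auto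
  have off: "1 / R (X w) = - (2 / pi) * ln (norm w) + (Re (deriv G w) - 2 / pi)" if w: "w \<in> S - \<real>\<^sub>\<ge>\<^sub>0" for w
  proof -
    have w0: "w \<noteq> 0" using w by auto
    have "(F has_field_derivative deriv F w) (at w)"
      by (rule holomorphic_derivI[OF F_holomorphic oS w])
    moreover have "((\<lambda>w. w * Ln (- w)) has_field_derivative Ln (- w) + 1) (at w)"
      using w w0 by (auto intro!: derivative_eq_intros simp: uminus_nonpos_Reals_iff)
    ultimately have "(?M has_field_derivative deriv F w + 2 / pi * (Ln (- w) + 1)) (at w)"
      by (intro DERIV_add DERIV_cmult)
    then have "(G has_field_derivative deriv F w + 2 / pi * (Ln (- w) + 1)) (at w)"
      by (rule has_field_derivative_transform_within_open[OF _ oS w]) (use G in simp)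
    then have "deriv G w = deriv F w + 2 / pi * (Ln (- w) + 1)" by (rule DERIV_imp_deriv)
    moreover have "Re (2 / pi * (Ln (- w) + 1)) = 2 / pi * (ln (norm w) + 1)"
      unfolding Re_of_real_mult using w0 by simp
    ultimately show ?thesis using Re_deriv_F[OF w] by (simp add: algebra_simps add_divide_distrib)
  qed
  have dG: "deriv G holomorphic_on S" by (rule holomorphic_deriv[OF G(1) open_S])
  have X0: "X w \<in> Omega - {(0, 0)}" if w: "w \<in> S - {0}" for w
  proof -
    obtain p where p: "p \<in> Omega" "w = T p" using w S_subset by blast
    then have "p \<noteq> (0, 0)" using w T_origin by blast
    then show ?thesis using p by simp
  qed
  show ?thesis
  proof (rule that[OF dG])
    fix w assume w: "w \<in> S - {0}"
    show "1 / R (X w) = - (2 / pi) * ln (norm w) + (Re (deriv G w) - 2 / pi)"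
    \<comment> \<open>The identity is known off the slit; both sides are continuous away from 0, the
      left one by the continuity of \<open>R\<close> across the slit, so it extends.\<close>
    proof (rule continuous_eq_across_slit[OF _ _ _ _ w, where g = "\<lambda>w. 1 / R (X w)"
          and h = "\<lambda>w. - (2 / pi) * ln (norm w) + (Re (deriv G w) - 2 / pi)"])
      show "open (S - {0})" using open_S by auto
      have "continuous_on (S - {0}) X"
        by (rule continuous_on_subset[OF continuous_on_X]) (use S_subset in blast)
      then have "continuous_on (S - {0}) (\<lambda>w. R (X w))"
        by (rule continuous_on_compose2[OF R_cont]) (rule image_subsetI, rule X0)
      moreover have "R (X w) \<noteq> 0" if "w \<in> S - {0}" for w
        using bspec[OF R_pos X0[OF that]] by simp
      ultimately show "continuous_on (S - {0}) (\<lambda>w. 1 / R (X w))" by (intro continuous_intros) auto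
      have "continuous_on (S - {0}) (deriv G)"
        by (rule continuous_on_subset[OF holomorphic_on_imp_continuous_on[OF dG]]) auto
      then show "continuous_on (S - {0}) (\<lambda>w. - (2 / pi) * ln (norm w) + (Re (deriv G w) - 2 / pi))"
        by (intro continuous_intros) auto
      show "1 / R (X w) = - (2 / pi) * ln (norm w) + (Re (deriv G w) - 2 / pi)" if "w \<in> S - {0} - \<real>\<^sub>\<ge>\<^sub>0" for w
        using off that by blast
    qed
  qed
qed

section \<open>Return to the real coordinates (u, v)\<close>

lemma interior_image:
  "interior ((\<lambda>p. (fst p - snd p, V p)) ` Omega) = cplx -` S" (is "interior (?f ` Omega) = _")
proof
  have T: "T p = cplx (?f p)" for p by (simp add: T_def)
  have "cplx ` interior (?f ` Omega) \<subseteq> interior (T ` Omega)"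
  proof (rule interior_maximal[OF _ open_cplx_image[OF open_interior]])
    have "T ` Omega = cplx ` ?f ` Omega" by (simp add: image_image T)
    then show "cplx ` interior (?f ` Omega) \<subseteq> T ` Omega" by (simp only: image_mono interior_subset)
  qed
  then show "interior (?f ` Omega) \<subseteq> cplx -` S" by (auto simp: interior_T_image)
  have "cplx -` S \<subseteq> ?f ` Omega"
  proof
    fix z assume "z \<in> cplx -` S"
    then obtain p where "p \<in> Omega" "cplx z = cplx (?f p)" using S_subset T by auto
    then have "p \<in> Omega" "z = ?f p" by (auto simp: complex_eq_iff prod_eq_iff)
    then show "z \<in> ?f ` Omega" by blast
  qed
  then show "cplx -` S \<subseteq> interior (?f ` Omega)"
    by (rule interior_maximal) (intro open_vimage open_S continuous_on_cplx)
qed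

text \<open>\<open>rinv\<close> is handled through its gradient, encoded by
  \<open>deriv G w - 2 / pi * (1 / w)\<close>, which is holomorphic on the punctured image; the
  remainder is the real part of a function holomorphic at the origin too.\<close>

lemma conformal_factor_harmonic:
  defines "f \<equiv> \<lambda>p. (fst p - snd p, V p)"
  defines "rinv \<equiv> \<lambda>z. 1 / R (the_inv_into Omega f z)"
  shows "\<exists>h. harmonic_on (interior (f ` Omega) - {(0, 0)}) rinv \<and> harmonic_on (interior (f ` Omega)) h \<and>
    smooth_on (interior (f ` Omega)) h \<and>
    (\<forall>z\<in>interior (f ` Omega) - {(0, 0)}. rinv z = - (2 / pi) * ln (norm z) + h z)"
proof -
  obtain G where G: "G holomorphic_on S"
    "\<And>w. w \<in> S - {0} \<Longrightarrow> 1 / R (X w) = - (2 / pi) * ln (norm w) + (Re (G w) - 2 / pi)"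
    using holomorphic_representation by blast
  define U where "U = cplx -` S"
  have U: "interior (f ` Omega) = U" unfolding f_def U_def by (rule interior_image)
  have oU: "open U" unfolding U_def by (intro open_vimage open_S continuous_on_cplx)
  have imU: "cplx ` U \<subseteq> S" and imU0: "cplx ` (U - {(0, 0)}) \<subseteq> S - {0}" by (auto simp: U_def)
  have dG: "deriv G holomorphic_on S" by (rule holomorphic_deriv[OF G(1) open_S])
  define h where "h z = Re (G (cplx z)) - 2 / pi" for z
  have h: "(h has_derivative (\<lambda>k. Re (deriv G (cplx z) * cplx k))) (at z)" if "z \<in> U" for z
  proof -
    have "(G has_field_derivative deriv G (cplx z)) (at (cplx z))"
      by (rule holomorphic_derivI[OF G(1) open_S]) (use that in \<open>simp add: U_def\<close>)
    from has_derivative_diff[OF has_derivative_Re_cplx[OF this] has_derivative_const[of "2 / pi"]]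
    show ?thesis by (simp add: h_def[abs_def])
  qed
  have rinv: "rinv z = - (2 / pi) * ln (norm z) + h z" if z: "z \<in> U - {(0, 0)}" for z
  proof -
    obtain p where p: "p \<in> Omega" "z = f p" using z interior_subset[of "f ` Omega"] by (auto simp: U[symmetric])
    have "the_inv_into Omega f z = p" unfolding p(2) by (rule the_inv_into_f_f) (use f_inj p in \<open>auto simp: f_def\<close>)
    moreover have "X (cplx z) = p" using X_T[OF p(1)] p(2) by (simp add: T_def f_def)
    ultimately have "rinv z = 1 / R (X (cplx z))" by (simp add: rinv_def)
    moreover have "cplx z \<in> S - {0}" using z imU0 by blast
    ultimately show ?thesis using G(2) by (simp add: h_def)
  qed
  have h': "smooth_on U h" "harmonic_on U h"
    using smooth_harmonic_if_gradient_holomorphic[OF oU holomorphic_on_subset[OF dG imU] h] by blast+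
  have oU0: "open (U - {(0, 0)})" using oU by auto
  have "harmonic_on (U - {(0, 0)}) rinv"
  proof (rule smooth_harmonic_if_gradient_holomorphic(2)[OF oU0])
    show "(\<lambda>w. deriv G w - 2 / pi * (1 / w)) holomorphic_on cplx ` (U - {(0, 0)})"
      by (rule holomorphic_on_subset[OF _ imU0])
         (intro holomorphic_intros holomorphic_on_subset[OF dG], auto)
    fix z assume z: "z \<in> U - {(0, 0)}"
    have "((\<lambda>z. - (2 / pi) * ln (norm z) + h z) has_derivative
        (\<lambda>k. - (2 / pi) * Re (1 / cplx z * cplx k) + Re (deriv G (cplx z) * cplx k))) (at z)"
      by (intro has_derivative_add has_derivative_mult_right has_derivative_ln_norm_cplx h) (use z in auto)
    then have "(rinv has_derivative
        (\<lambda>k. - (2 / pi) * Re (1 / cplx z * cplx k) + Re (deriv G (cplx z) * cplx k))) (at z)"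
      by (rule has_derivative_transform_within_open[OF _ oU0 z]) (use rinv in simp)
    moreover have "Re ((deriv G (cplx z) - 2 / pi * (1 / cplx z)) * cplx k) =
        - (2 / pi) * Re (1 / cplx z * cplx k) + Re (deriv G (cplx z) * cplx k)" for k
    proof -
      have "Re ((deriv G (cplx z) - 2 / pi * (1 / cplx z)) * cplx k) =
          Re (deriv G (cplx z) * cplx k) - 2 / pi * Re (1 / cplx z * cplx k)"
        by (simp only: left_diff_distrib mult.assoc minus_complex.sel Re_of_real_mult)
      then show ?thesis by linarith
    qed
    ultimately show "(rinv has_derivative (\<lambda>k. Re ((deriv G (cplx z) - 2 / pi * (1 / cplx z)) * cplx k))) (at z)"
      by (simp only:)
  qed
  then show ?thesis using h' rinv unfolding U by blast
qed

end

theorem theorem4p5: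
  fixes \<phi> V R :: "real \<times> real \<Rightarrow> real"
  assumes convex: "convex_on Omega \<phi>"
    and smooth: "smooth_on (interior Omega - Ray) \<phi>"
    and MA: "\<forall>p\<in>interior Omega - Ray.
               px (px \<phi>) p * py (py \<phi>) p - (py (px \<phi>) p)\<^sup>2 = 1"
    and pushforward: "\<forall>B\<in>sets lborel.
        emeasure lborel {p \<in> interior Omega - Ray. (px \<phi> p, py \<phi> p) \<in> B}
          = emeasure lborel (Theta \<inter> B)"
    and V_cont: "continuous_on Omega V"
    and V_eq: "\<forall>p\<in>interior Omega - Ray. V p = px \<phi> p + py \<phi> p"
    and R_cont: "continuous_on (Omega - {(0, 0)}) R"
    and R_pos: "\<forall>p\<in>Omega - {(0, 0)}. R p > 0"
    and R_eq: "\<forall>p\<in>interior Omega - Ray.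
               R p = px (px \<phi>) p + 2 * py (px \<phi>) p + py (py \<phi>) p"
    and f_inj: "inj_on (\<lambda>p. (fst p - snd p, V p)) Omega"
    and f_origin: "V (0, 0) = 0"
  shows "let f = (\<lambda>p. (fst p - snd p, V p));
             Omega' = f ` Omega;
             rinv = (\<lambda>z. 1 / R (the_inv_into Omega f z))
         in harmonic_on (interior Omega' - {(0, 0)}) rinv
            \<and> (\<exists>C::real. C \<ge> 0 \<and> (\<exists>h. harmonic_on (interior Omega') h
                   \<and> smooth_on (interior Omega') h
                   \<and> (\<forall>z\<in>interior Omega' - {(0, 0)}. rinv z = - C * ln (norm z) + h z)))"
proof -
  interpret brenier \<phi> V R by unfold_locales fact+
  have "0 \<le> 2 / pi" by simp
  then show ?thesis unfolding Let_def using conformal_factor_harmonic by blast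
qed

end
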